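(* Let $X=\{X_1,\ldots,X_m\}$ be a family of linearly independent smooth vector fields on $\mathbb{R}^n$ satisfying (H.1) and (H.2) (see context). Let $\Omega\subseteq\mathbb{R}^n$ be a bounded connected open set, regular for the Divergence Theorem and $\delta_\lambda$-star shaped with respect to the origin (see context), and let $\mathcal{F}=\mathcal{F}(x,z,p,r):\Omega\times\mathbb{R}\times\mathbb{R}^m\times\mathbb{R}^{m^2}\to\mathbb{R}$, $r=\{r_{ij}\}_{i,j=1}^m$, satisfy (P.1), (P.2) and (P.3) (see context). Assume that: (i) for every $x\in\partial\Omega$ and every $r\in\mathbb{R}^{m^2}$, $$\mathcal{F}(x,0,0,r)-\sum_{i,j=1}^mr_{ij}\,\mathcal{F}_{r_{ij}}(x,0,0,r)\le0;$$ (ii) for every $x\in\Omega$ and every $(z,p,r)\in\mathbb{R}\times\mathbb{R}^m\times\mathbb{R}^{m^2}$, $$q\,\mathcal{F}(x,z,p,r)-\langle p,\mathcal{F}_p(x,z,p,r)\rangle+\sum_{i=1}^n\sigma_ix_i\,\partial_{x_i}\mathcal{F}(x,z,p,r)-2\sum_{i,j=1}^mr_{ij}\,\mathcal{F}_{r_{ij}}(x,z,p,r)\ge0;$$ (iii) either $z=0$ or $p=0$ or $r=0$ whenever equality holds in the inequality of (ii) at $(x,z,p,r)$. Then the boundary-value problem $$\begin{cases}\displaystyle\sum_{i,j=1}^mX_iX_j(\mathcal{F}_{r_{ij}})+\mathrm{div}_X(\mathcal{F}_p)+\partial_z\mathcal{F}=0&\text{in }\Omega,\\ u|_{\partial\Omega}=0,\\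 \nabla u|_{\partial\Omega}=0,\end{cases}$$ where $\mathcal{F}_{r_{ij}}$, $\mathcal{F}_p$, $\partial_z\mathcal{F}$ are evaluated at $(x,u(x),\nabla_Xu(x),\mathcal{H}_Xu(x))$ (and then differentiated as functions of $x$) and $\nabla$ is the full Euclidean gradient, has no non-trivial solutions $u\in C^4(\overline\Omega)$; that is, every solution $u\in C^4(\overline\Omega)$ satisfies $u\equiv0$ in $\Omega$.
   Context: Assumptions on the vector fields. $X_1,\ldots,X_m$ are smooth vector fields on $\mathbb{R}^n$, linearly independent (as elements of the real vector space of smooth vector fields), such that: (H.1) $X_1,\ldots,X_m$ are homogeneous of degree $1$ with respect to a family of dilations $\delta_\lambda(x)=(\lambda^{\sigma_1}x_1,\ldots,\lambda^{\sigma_n}x_n)$, $\lambda>0$, where $\sigma_1,\ldots,\sigma_n\in\mathbb{N}$ and $1=\sigma_1\le\cdots\le\sigma_n$; that is, $X_i(u\circ\delta_\lambda)=\lambda\,(X_iu)\circ\delta_\lambda$ for all $u\in C^\infty(\mathbb{R}^n)$, $\lambda>0$ and $i=1,\ldots,m$. (H.2) Hörmander's condition at $0$: $\dim\{Y(0):Y\in\mathrm{Lie}(X)\}=n$, where $\mathrm{Lie}(X)$ is the smallest Lie subalgebra of the smooth vector fields on $\mathbb{R}^n$ containing $X$, and $Y(0)\in\mathbb{R}^n$ is the coefficient vector of $Y$ at $0$. Notation. $q:=\sum_{k=1}^n\sigma_k$. $\mathrm{T}:=\sum_{i=1}^n\sigma_i x_i\partial_{x_i}$, so $\mathrm{T}(x)=(\sigma_1x_1,\ldots,\sigma_nx_n)$.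 $\nabla_Xu=(X_1u,\ldots,X_mu)$. $\mathcal{H}_Xu:=\big(X_j(X_iu)\big)_{i,j=1}^m$ is the $X$-Hessian (in general not symmetric), and its $(i,j)$ entry $X_j(X_iu)$ is substituted for the variable $r_{ij}$. For $V=(V_1,\ldots,V_m)$ of class $C^1$, $\mathrm{div}_XV:=-\sum_{i=1}^mX_iV_i$ (note the minus sign). $\mathcal{F}_p=(\partial_{p_1}\mathcal{F},\ldots,\partial_{p_m}\mathcal{F})$ and $\mathcal{F}_{r_{ij}}=\partial_{r_{ij}}\mathcal{F}$. "Regular for the Divergence Theorem" has its usual meaning: $H^{n-1}(\partial\Omega)<\infty$ ($H^{n-1}$ being the $(n-1)$-dimensional Hausdorff measure), the outward unit normal $\nu$ is defined $H^{n-1}$-a.e. on $\partial\Omega$, and $\int_\Omega\mathrm{div}\,V\,dx=\int_{\partial\Omega}\langle V,\nu\rangle\,dH^{n-1}$ for all $V\in C^1(\overline\Omega;\mathbb{R}^n)$. A non-empty open set $\Omega\subseteq\mathbb{R}^n$ with $C^1$ boundary is called $\delta_\lambda$-star shaped (with respect to the origin) if $\langle\mathrm{T}(x),\nu\rangle\ge0$ for every $x\in\partial\Omega$, where $\nu$ is the outward unit normal to $\partial\Omega$ at $x$. Assumptions on $\mathcal{F}$, with $\mathcal{O}:=\Omega\times\mathbb{R}\times\mathbb{R}^m\times\mathbb{R}^{m^2}$: (P.1) $\mathcal{F}$ is of class $C^1$ on (an open neighborhood of) $\overline{\mathcal{O}}$; (P.2) for every $i=1,\ldots,m$, $\partial_{p_i}\mathcal{F}$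 is of class $C^1$ on $\overline{\mathcal{O}}$; (P.3) for every $i,j=1,\ldots,m$, $\partial_{r_{ij}}\mathcal{F}$ is of class $C^2$ on $\overline{\mathcal{O}}$. *)

theory Defs
  imports "HOL-Analysis.Analysis"
begin

section \<open>Classes of differentiable functions\<close>

text \<open>Intended for open \<open>S\<close>: there \<open>f\<close> is of class \<open>C^k\<close> iff it is differentiable and all its partial
  derivatives are of class \<open>C^(k-1)\<close>.\<close>

primrec Ck_on :: "nat \<Rightarrow> ('a::euclidean_space \<Rightarrow> 'b::real_normed_vector) \<Rightarrow> 'a set \<Rightarrow> bool" where
  "Ck_on 0 f S \<longleftrightarrow> continuous_on S f"
| "Ck_on (Suc k) f S \<longleftrightarrow>
     (\<forall>x\<in>S. f differentiable (at x)) \<and>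
     (\<forall>b\<in>Basis. Ck_on k (\<lambda>x. frechet_derivative f (at x) b) S)"

definition smooth :: "('a::euclidean_space \<Rightarrow> 'b::real_normed_vector) \<Rightarrow> bool" where
  "smooth f \<longleftrightarrow> (\<forall>k. Ck_on k f UNIV)"

definition continuously_extends :: "('a::topological_space \<Rightarrow> 'b::topological_space) \<Rightarrow> 'a set \<Rightarrow> bool" where
  "continuously_extends f S \<longleftrightarrow>
     (\<exists>g. continuous_on (closure S) g \<and> (\<forall>x\<in>S. g x = f x))"

primrec Ck_extends :: "nat \<Rightarrow> ('a::euclidean_space \<Rightarrow> 'b::real_normed_vector) \<Rightarrow> 'a set \<Rightarrow> bool" where
  "Ck_extends 0 f S \<longleftrightarrow> continuously_extends f S"
| "Ck_extends (Suc k) f S \<longleftrightarrow>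
     continuously_extends f S \<and>
     (\<forall>x\<in>S. f differentiable (at x)) \<and>
     (\<forall>b\<in>Basis. Ck_extends k (\<lambda>x. frechet_derivative f (at x) b) S)"

text \<open>The space \<open>C^k\<close> of the closure of an open set \<open>S\<close>: functions of class \<open>C^k\<close> in \<open>S\<close> all of whose
  partial derivatives of order at most \<open>k\<close> extend continuously from \<open>S\<close> to the closure. The values of
  \<open>f\<close> itself on the frontier are the extended ones; derivatives of \<open>f\<close> are only ever taken in \<open>S\<close>.\<close>

definition Ck_closure :: "nat \<Rightarrow> ('a::euclidean_space \<Rightarrow> 'b::real_normed_vector) \<Rightarrow> 'a set \<Rightarrow> bool" where
  "Ck_closure k f S \<longleftrightarrow> continuous_on (closure S) f \<and> Ck_extends k f S"

definition grad :: "(real^'n \<Rightarrow> real) \<Rightarrow> real^'n::finite \<Rightarrow> real^'n" where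
  "grad f x = (\<chi> k. frechet_derivative f (at x) (axis k 1))"

definition divergence :: "(real^'n \<Rightarrow> real^'n) \<Rightarrow> real^'n::finite \<Rightarrow> real" where
  "divergence V x = (\<Sum>k\<in>UNIV. frechet_derivative V (at x) (axis k 1) $ k)"


section \<open>Vector fields\<close>

text \<open>A vector field is given by its coefficient map \<open>Y\<close>; as a differential operator it acts on
  functions by \<open>Y f = (\<Sum>k. Y_k \<partial>_k f)\<close>.\<close>

definition vf :: "(real^'n \<Rightarrow> real^'n) \<Rightarrow> (real^'n \<Rightarrow> real) \<Rightarrow> real^'n::finite \<Rightarrow> real" where
  "vf Y f x = frechet_derivative f (at x) (Y x)"

text \<open>The coefficient map of the commutator \<open>Y Z - Z Y\<close>.\<close>

definition lie_bracket ::
    "(real^'n \<Rightarrow> real^'n) \<Rightarrow> (real^'n \<Rightarrow> real^'n) \<Rightarrow> real^'n::finite \<Rightarrow> real^'n" where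
  "lie_bracket Y Z x = frechet_derivative Z (at x) (Y x) - frechet_derivative Y (at x) (Z x)"

inductive_set lie_algebra :: "('m \<Rightarrow> real^'n \<Rightarrow> real^'n) \<Rightarrow> (real^'n::finite \<Rightarrow> real^'n) set"
  for X :: "'m \<Rightarrow> real^'n \<Rightarrow> real^'n" where
  generator: "X i \<in> lie_algebra X"
| zero: "(\<lambda>x. 0) \<in> lie_algebra X"
| add: "Y \<in> lie_algebra X \<Longrightarrow> Z \<in> lie_algebra X \<Longrightarrow> (\<lambda>x. Y x + Z x) \<in> lie_algebra X"
| scale: "Y \<in> lie_algebra X \<Longrightarrow> (\<lambda>x. c *\<^sub>R Y x) \<in> lie_algebra X"
| bracket: "Y \<in> lie_algebra X \<Longrightarrow> Z \<in> lie_algebra X \<Longrightarrow> lie_bracket Y Z \<in> lie_algebra X"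

definition linearly_independent_fields :: "('m::finite \<Rightarrow> real^'n \<Rightarrow> real^'n::finite) \<Rightarrow> bool" where
  "linearly_independent_fields X \<longleftrightarrow>
     (\<forall>c :: 'm \<Rightarrow> real. (\<forall>x. (\<Sum>i\<in>UNIV. c i *\<^sub>R X i x) = 0) \<longrightarrow> (\<forall>i. c i = 0))"

definition dil :: "('n \<Rightarrow> nat) \<Rightarrow> real \<Rightarrow> real^'n::finite \<Rightarrow> real^'n" where
  "dil \<sigma> l x = (\<chi> k. l ^ \<sigma> k * x $ k)"

text \<open>The linear order of the index type plays the role of the order of the indices \<open>1, \<dots>, n\<close>.\<close>

definition dilation_exponents :: "('n::{finite,linorder} \<Rightarrow> nat) \<Rightarrow> bool" where
  "dilation_exponents \<sigma> \<longleftrightarrow> \<sigma> (Min UNIV) = 1 \<and> mono \<sigma>"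

definition homogeneous_field :: "('n \<Rightarrow> nat) \<Rightarrow> (real^'n \<Rightarrow> real^'n::finite) \<Rightarrow> bool" where
  "homogeneous_field \<sigma> Y \<longleftrightarrow>
     (\<forall>u. smooth u \<longrightarrow> (\<forall>l>0. \<forall>x. vf Y (u \<circ> dil \<sigma> l) x = l * vf Y u (dil \<sigma> l x)))"

definition hormander_at_0 :: "('m \<Rightarrow> real^'n \<Rightarrow> real^'n::finite) \<Rightarrow> bool" where
  "hormander_at_0 X \<longleftrightarrow> dim {Y 0 |Y. Y \<in> lie_algebra X} = CARD('n)"

definition hom_dim :: "('n::finite \<Rightarrow> nat) \<Rightarrow> nat" where
  "hom_dim \<sigma> = (\<Sum>k\<in>UNIV. \<sigma> k)"

definition euler_field :: "('n \<Rightarrow> nat) \<Rightarrow> real^'n::finite \<Rightarrow> real^'n" where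
  "euler_field \<sigma> x = (\<chi> k. real (\<sigma> k) * x $ k)"

definition X_grad :: "('m::finite \<Rightarrow> real^'n \<Rightarrow> real^'n) \<Rightarrow> (real^'n \<Rightarrow> real) \<Rightarrow> real^'n::finite \<Rightarrow> real^'m" where
  "X_grad X u x = (\<chi> i. vf (X i) u x)"

text \<open>Pitfall: the entry in row \<open>i\<close> and column \<open>j\<close> is \<open>X_j (X_i u)\<close>.\<close>

definition X_hess :: "('m::finite \<Rightarrow> real^'n \<Rightarrow> real^'n) \<Rightarrow> (real^'n \<Rightarrow> real) \<Rightarrow> real^'n::finite \<Rightarrow> real^'m^'m" where
  "X_hess X u x = (\<chi> i j. vf (X j) (vf (X i) u) x)"

text \<open>Pitfall: by convention this divergence carries a minus sign.\<close>

definition X_div :: "('m::finite \<Rightarrow> real^'n \<Rightarrow> real^'n) \<Rightarrow> (real^'n \<Rightarrow> real^'m) \<Rightarrow> real^'n::finite \<Rightarrow> real" where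
  "X_div X V x = - (\<Sum>i\<in>UNIV. vf (X i) (\<lambda>y. V y $ i) x)"


section \<open>Hausdorff measure\<close>

text \<open>The normalisation by the volume of the unit ball of dimension \<open>d\<close> is the one which makes the
  divergence theorem true. The case distinction on the empty set matters only for \<open>d = 0\<close>, where
  \<open>0 ^ 0 = 1\<close> and the result is the counting measure.\<close>

definition hausdorff_gauge :: "nat \<Rightarrow> 'a::metric_space set \<Rightarrow> ennreal" where
  "hausdorff_gauge d S =
     (if S = {} then 0 else ennreal (unit_ball_vol (real d) * (diameter S / 2) ^ d))"

definition hausdorff_pre :: "nat \<Rightarrow> real \<Rightarrow> 'a::metric_space set \<Rightarrow> ennreal" where
  "hausdorff_pre d \<delta> A =
     (INF C \<in> {C :: nat \<Rightarrow> 'a set. A \<subseteq> (\<Union>k. C k) \<and> (\<forall>k. bounded (C k) \<and> diameter (C k) \<le> \<delta>)}.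
        \<Sum>k. hausdorff_gauge d (C k))"

definition hausdorff_outer :: "nat \<Rightarrow> 'a::metric_space set \<Rightarrow> ennreal" where
  "hausdorff_outer d A = (SUP \<delta> \<in> {0<..}. hausdorff_pre d \<delta> A)"

text \<open>The outer measure is a metric outer measure, hence countably additive on the Borel sets, so this
  is its restriction to the Borel sets.\<close>

definition hausdorff_measure :: "nat \<Rightarrow> 'a::metric_space measure" where
  "hausdorff_measure d = measure_of UNIV (sets borel) (hausdorff_outer d)"


section \<open>Domains\<close>

text \<open>\<open>\<phi>\<close> is a \<open>C^1\<close> function describing \<open>\<Omega>\<close> and its boundary in the neighbourhood \<open>U\<close> of the boundary
  point \<open>x\<close>, with \<open>\<Omega>\<close> on one side of its boundary.\<close>

definition C1_defining :: "(real^'n::finite) set \<Rightarrow> real^'n \<Rightarrow> (real^'n) set \<Rightarrow> (real^'n \<Rightarrow> real) \<Rightarrow> bool" where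
  "C1_defining \<Omega> x U \<phi> \<longleftrightarrow>
     open U \<and> x \<in> U \<and> Ck_on 1 \<phi> U \<and> (\<forall>y\<in>U. grad \<phi> y \<noteq> 0) \<and>
     \<Omega> \<inter> U = {y \<in> U. \<phi> y < 0} \<and> frontier \<Omega> \<inter> U = {y \<in> U. \<phi> y = 0}"

definition C1_boundary :: "(real^'n::finite) set \<Rightarrow> bool" where
  "C1_boundary \<Omega> \<longleftrightarrow> (\<forall>x\<in>frontier \<Omega>. \<exists>U \<phi>. C1_defining \<Omega> x U \<phi>)"

definition is_outward_normal :: "(real^'n::finite) set \<Rightarrow> real^'n \<Rightarrow> real^'n \<Rightarrow> bool" where
  "is_outward_normal \<Omega> x \<nu> \<longleftrightarrow>
     x \<in> frontier \<Omega> \<and> (\<exists>U \<phi>. C1_defining \<Omega> x U \<phi> \<and> \<nu> = grad \<phi> x /\<^sub>R norm (grad \<phi> x))"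

text \<open>The outward unit normal does not depend on the defining function, so there is no real choice
  here.\<close>

definition outward_normal :: "(real^'n::finite) set \<Rightarrow> real^'n \<Rightarrow> real^'n" where
  "outward_normal \<Omega> x = (SOME \<nu>. is_outward_normal \<Omega> x \<nu>)"

definition divergence_regular :: "(real^'n::finite) set \<Rightarrow> bool" where
  "divergence_regular \<Omega> \<longleftrightarrow>
     hausdorff_outer (CARD('n) - 1) (frontier \<Omega>) < \<infinity> \<and>
     (AE x in hausdorff_measure (CARD('n) - 1). x \<in> frontier \<Omega> \<longrightarrow> (\<exists>\<nu>. is_outward_normal \<Omega> x \<nu>)) \<and>
     (\<forall>V :: real^'n \<Rightarrow> real^'n. Ck_closure 1 V \<Omega> \<longrightarrow>
        (LINT x:\<Omega>|lborel. divergence V x) =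
        (LINT x:frontier \<Omega>|hausdorff_measure (CARD('n) - 1). V x \<bullet> outward_normal \<Omega> x))"

definition dil_star_shaped :: "('n \<Rightarrow> nat) \<Rightarrow> (real^'n::finite) set \<Rightarrow> bool" where
  "dil_star_shaped \<sigma> \<Omega> \<longleftrightarrow>
     \<Omega> \<noteq> {} \<and> open \<Omega> \<and> C1_boundary \<Omega> \<and>
     (\<forall>x\<in>frontier \<Omega>. euler_field \<sigma> x \<bullet> outward_normal \<Omega> x \<ge> 0)"


section \<open>The Lagrangian and the boundary-value problem\<close>

text \<open>Points of the jet space are \<open>(x, z, p, r)\<close>, where \<open>r $ i $ j\<close> is the variable \<open>r_ij\<close>.\<close>

type_synonym ('n, 'm) jet = "(real^'n) \<times> real \<times> (real^'m) \<times> (real^'m^'m)"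

definition d_x :: "(('n::finite, 'm::finite) jet \<Rightarrow> real) \<Rightarrow> 'n \<Rightarrow> ('n, 'm) jet \<Rightarrow> real" where
  "d_x F k w = frechet_derivative F (at w) (axis k 1, 0, 0, 0)"

definition d_z :: "(('n::finite, 'm::finite) jet \<Rightarrow> real) \<Rightarrow> ('n, 'm) jet \<Rightarrow> real" where
  "d_z F w = frechet_derivative F (at w) (0, 1, 0, 0)"

definition d_p :: "(('n::finite, 'm::finite) jet \<Rightarrow> real) \<Rightarrow> 'm \<Rightarrow> ('n, 'm) jet \<Rightarrow> real" where
  "d_p F i w = frechet_derivative F (at w) (0, 0, axis i 1, 0)"

definition d_r :: "(('n::finite, 'm::finite) jet \<Rightarrow> real) \<Rightarrow> 'm \<Rightarrow> 'm \<Rightarrow> ('n, 'm) jet \<Rightarrow> real" where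
  "d_r F i j w = frechet_derivative F (at w) (0, 0, 0, axis i (axis j 1))"

definition jet_domain :: "(real^'n::finite) set \<Rightarrow> ('n, 'm::finite) jet set" where
  "jet_domain \<Omega> = \<Omega> \<times> UNIV"

definition lagrangian_regular ::
    "(real^'n::finite) set \<Rightarrow> (('n, 'm::finite) jet \<Rightarrow> real) \<Rightarrow> bool" where
  "lagrangian_regular \<Omega> F \<longleftrightarrow>
     (\<exists>N. open N \<and> closure (jet_domain \<Omega>) \<subseteq> N \<and> Ck_on 1 F N) \<and>
     (\<forall>i. Ck_closure 1 (d_p F i) (jet_domain \<Omega>)) \<and>
     (\<forall>i j. Ck_closure 2 (d_r F i j) (jet_domain \<Omega>))"

definition jet_of ::
    "('m::finite \<Rightarrow> real^'n \<Rightarrow> real^'n) \<Rightarrow> (real^'n \<Rightarrow> real) \<Rightarrow> real^'n::finite \<Rightarrow> ('n, 'm) jet" where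
  "jet_of X u x = (x, u x, X_grad X u x, X_hess X u x)"

text \<open>For \<open>u\<close> of class \<open>C^1\<close> up to the boundary, the value of the gradient at a boundary point is its
  limit from inside \<open>\<Omega>\<close>.\<close>

definition solves_bvp ::
    "('m::finite \<Rightarrow> real^'n \<Rightarrow> real^'n) \<Rightarrow> (('n::finite, 'm) jet \<Rightarrow> real) \<Rightarrow> (real^'n) set \<Rightarrow>
     (real^'n \<Rightarrow> real) \<Rightarrow> bool" where
  "solves_bvp X F \<Omega> u \<longleftrightarrow>
     (\<forall>x\<in>\<Omega>.
        (\<Sum>i\<in>UNIV. \<Sum>j\<in>UNIV. vf (X i) (vf (X j) (\<lambda>y. d_r F i j (jet_of X u y))) x)
        + X_div X (\<lambda>y. \<chi> i. d_p F i (jet_of X u y)) x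
        + d_z F (jet_of X u x) = 0) \<and>
     (\<forall>x\<in>frontier \<Omega>. u x = 0) \<and>
     (\<forall>x\<in>frontier \<Omega>. (grad u \<longlongrightarrow> 0) (at x within \<Omega>))"

definition pohozaev_density ::
    "('n \<Rightarrow> nat) \<Rightarrow> (('n::finite, 'm::finite) jet \<Rightarrow> real) \<Rightarrow>
     real^'n \<Rightarrow> real \<Rightarrow> real^'m \<Rightarrow> real^'m^'m \<Rightarrow> real" where
  "pohozaev_density \<sigma> F x z p r =
     real (hom_dim \<sigma>) * F (x, z, p, r)
     - p \<bullet> (\<chi> i. d_p F i (x, z, p, r))
     + (\<Sum>k\<in>UNIV. real (\<sigma> k) * x $ k * d_x F k (x, z, p, r))
     - 2 * (\<Sum>i\<in>UNIV. \<Sum>j\<in>UNIV. r $ i $ j * d_r F i j (x, z, p, r))"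

end

theory Submission
  imports Defs
begin

text \<open>
The proof is a Pohozaev argument. Let \<open>T\<close> be the Euler field of the dilations, \<open>q\<close> the homogeneous
dimension, and for a solution \<open>u\<close> write \<open>f\<close>, \<open>P_i\<close>, \<open>G_ij\<close> for \<open>F\<close>, \<open>F_p_i\<close>, \<open>F_r_ij\<close> along the jet of \<open>u\<close>.
Homogeneity of degree \<open>1\<close> says \<open>X_i T = T X_i + X_i\<close> as operators and makes every \<open>X_i\<close>
divergence-free, while \<open>div T = q\<close>. With these rules, the chain rule for \<open>T f\<close> and the equation, the
field
\<open>V = f T - (\<Sum>i. P_i (T u) X_i) + (\<Sum>i j. W_ij)\<close>, where
\<open>W_ij = - X_j (G_ij X_i u) T + X_j (G_ij) (T u) X_i + X_i u (T G_ij + (q - 2) G_ij) X_j\<close>,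
has as its divergence exactly the left-hand side of the structural inequality, evaluated along the jet
of \<open>u\<close> (lemma \<open>divergence_pohozaev_field\<close>). So \<open>div V\<close> is non-negative.

On the boundary \<open>u\<close> and its gradient vanish, so \<open>V\<close> reduces to
\<open>(F - (\<Sum>i j. r_ij F_r_ij)) T\<close> (lemma \<open>tendsto_pohozaev_field\<close>). The boundary inequality and
star-shapedness make its normal component non-positive, and the divergence theorem forces \<open>div V = 0\<close>
in the domain. The choice of \<open>W_ij\<close> matters here: the field that comes directly out of integrating
by parts contains the terms \<open>G_ij (X_i T u) X_j\<close>, which do not vanish on the boundary and would have to be
compared with \<open>T\<close> through the normal derivative of \<open>X_i u\<close>. They are removed by adding a divergence-free
field.

Hence at every point \<open>u = 0\<close>, or \<open>X_i u = 0\<close> for all \<open>i\<close>, or \<open>X_j (X_i u) = 0\<close> for all \<open>i\<close> and \<open>j\<close>.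
Hormander's condition at the origin propagates along the dilations to every point (lemma
\<open>hormander_everywhere\<close>), so a function annihilated by all the \<open>X_i\<close> on an open set is locally constant
there. Two applications of this, to the functions \<open>X_i u\<close> and then to \<open>u\<close> itself, on components of
suitable open sets, leave only \<open>u = 0\<close> (lemma \<open>vanishing_product_imp_zero\<close>).
\<close>

section \<open>Functions of class \<open>C^k\<close> up to the boundary\<close>

lemma continuously_extends_cong:
  assumes "\<And>x. x \<in> S \<Longrightarrow> f x = g x"
  shows "continuously_extends f S \<longleftrightarrow> continuously_extends g S"
  using assms unfolding continuously_extends_def by auto

lemma continuously_extends_subset:
  "continuously_extends f S \<Longrightarrow> S' \<subseteq> S \<Longrightarrow> continuously_extends f S'"
  unfolding continuously_extends_def using continuous_on_subset[OF _ closure_mono] by blast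

lemma continuous_on_closure_imp_continuously_extends:
  "continuous_on (closure S) f \<Longrightarrow> continuously_extends f S"
  unfolding continuously_extends_def by auto

lemma continuous_on_closure_tendsto:
  assumes "continuous_on (closure S) f" "x \<in> closure S"
  shows "(f \<longlongrightarrow> f x) (at x within S)"
proof -
  have "(f \<longlongrightarrow> f x) (at x within closure S)"
    using assms by (simp add: continuous_on_def)
  then show ?thesis
    using closure_subset by (rule tendsto_within_subset)
qed

lemma continuously_extends_limit:
  assumes "continuously_extends f S" "x \<in> closure S"
  obtains l where "(f \<longlongrightarrow> l) (at x within S)"
proof -
  obtain g where g: "continuous_on (closure S) g" "\<And>x. x \<in> S \<Longrightarrow> g x = f x"
    using assms(1) unfolding continuously_extends_def by auto
  have "(g \<longlongrightarrow> g x) (at x within S)"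
    by (rule continuous_on_closure_tendsto[OF g(1) assms(2)])
  then have "(f \<longlongrightarrow> g x) (at x within S)"
    by (rule Lim_transform_eventually) (auto simp: eventually_at_topological g(2))
  then show ?thesis by (rule that)
qed

lemma continuously_extends_imp_continuous_on:
  assumes "continuously_extends f S"
  shows "continuous_on S f"
proof -
  obtain g where g: "continuous_on (closure S) g" "\<And>x. x \<in> S \<Longrightarrow> g x = f x"
    using assms unfolding continuously_extends_def by auto
  have "continuous_on S g" using continuous_on_subset[OF g(1) closure_subset] .
  then show ?thesis by (rule continuous_on_eq) (rule g(2))
qed

lemma continuously_extends_bilinear:
  assumes "bounded_bilinear pr" "continuously_extends f S" "continuously_extends g S"
  shows "continuously_extends (\<lambda>x. pr (f x) (g x)) S"
proof -
  obtain f' g' where "continuous_on (closure S) f'" "\<And>x. x \<in> S \<Longrightarrow> f' x = f x"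
    "continuous_on (closure S) g'" "\<And>x. x \<in> S \<Longrightarrow> g' x = g x"
    using assms unfolding continuously_extends_def by auto
  then show ?thesis
    unfolding continuously_extends_def
    by (intro exI[of _ "\<lambda>x. pr (f' x) (g' x)"])
       (auto intro!: bounded_bilinear.continuous_on[OF assms(1)])
qed

lemma continuously_extends_linear:
  assumes "bounded_linear h" "continuously_extends f S"
  shows "continuously_extends (\<lambda>x. h (f x)) S"
proof -
  obtain f' where "continuous_on (closure S) f'" "\<And>x. x \<in> S \<Longrightarrow> f' x = f x"
    using assms unfolding continuously_extends_def by auto
  then show ?thesis
    unfolding continuously_extends_def
    by (intro exI[of _ "\<lambda>x. h (f' x)"])
       (auto intro!: bounded_linear.continuous_on[OF assms(1)])
qed

lemma continuously_extends_add:
  fixes f g :: "_ \<Rightarrow> 'b::real_normed_vector"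
  assumes "continuously_extends f S" "continuously_extends g S"
  shows "continuously_extends (\<lambda>x. f x + g x) S"
proof -
  obtain f' g' where "continuous_on (closure S) f'" "\<And>x. x \<in> S \<Longrightarrow> f' x = f x"
    "continuous_on (closure S) g'" "\<And>x. x \<in> S \<Longrightarrow> g' x = g x"
    using assms unfolding continuously_extends_def by auto
  then show ?thesis
    unfolding continuously_extends_def
    by (intro exI[of _ "\<lambda>x. f' x + g' x"]) (auto intro!: continuous_intros)
qed

lemma continuously_extends_compose:
  fixes f :: "'a::metric_space \<Rightarrow> 'b::metric_space"
  assumes "continuously_extends f S" "continuously_extends g S'" "f ` S \<subseteq> S'"
  shows "continuously_extends (\<lambda>x. g (f x)) S"
proof -
  obtain f' g' where f': "continuous_on (closure S) f'" "\<And>x. x \<in> S \<Longrightarrow> f' x = f x"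
    and g': "continuous_on (closure S') g'" "\<And>x. x \<in> S' \<Longrightarrow> g' x = g x"
    using assms unfolding continuously_extends_def by auto
  have "f' ` closure S \<subseteq> closure S'"
    using f'(2) assms(3) closure_subset[of S']
    by (intro image_closure_subset[OF f'(1) closed_closure]) auto
  then have "continuous_on (closure S) (\<lambda>x. g' (f' x))"
    using continuous_on_compose2[OF g'(1) f'(1)] by auto
  then show ?thesis
    unfolding continuously_extends_def using f'(2) g'(2) assms(3)
    by (intro exI[of _ "\<lambda>x. g' (f' x)"]) auto
qed

lemma frechet_derivative_eq_on_open:
  assumes "open S" "x \<in> S" "\<And>y. y \<in> S \<Longrightarrow> f y = g y"
  shows "frechet_derivative f (at x) = frechet_derivative g (at x)"
proof -
  have "(f has_derivative D) (at x) \<longleftrightarrow> (g has_derivative D) (at x)" for D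
    using has_derivative_transform_within_open[OF _ assms(1,2), of f D UNIV g]
      has_derivative_transform_within_open[OF _ assms(1,2), of g D UNIV f] assms(3) by auto
  then show ?thesis unfolding frechet_derivative_def by simp
qed

lemma differentiable_eq_on_open:
  assumes "open S" "x \<in> S" "\<And>y. y \<in> S \<Longrightarrow> f y = g y" "f differentiable (at x)"
  shows "g differentiable (at x)"
proof -
  obtain D where "(f has_derivative D) (at x)" using assms(4) unfolding differentiable_def by blast
  then have "(g has_derivative D) (at x)"
    by (rule has_derivative_transform_within_open[OF _ assms(1,2)]) (rule assms(3))
  then show ?thesis unfolding differentiable_def by blast
qed

lemma Ck_extends_imp_continuously_extends: "Ck_extends k f S \<Longrightarrow> continuously_extends f S"
  by (cases k) auto

lemma Ck_extends_continuous_on: "Ck_extends k f S \<Longrightarrow> continuous_on S f"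
  using Ck_extends_imp_continuously_extends continuously_extends_imp_continuous_on by blast

lemma Ck_extends_cong:
  assumes "open S" "\<And>x. x \<in> S \<Longrightarrow> f x = g x" "Ck_extends k f S"
  shows "Ck_extends k g S"
  using assms(2,3)
proof (induction k arbitrary: f g)
  case 0
  then show ?case using continuously_extends_cong[of S f g] by simp
next
  case (Suc k)
  have "continuously_extends g S"
    using continuously_extends_cong[of S f g] Suc.prems by simp
  moreover have "\<forall>x\<in>S. g differentiable (at x)"
    using differentiable_eq_on_open[OF assms(1) _ Suc.prems(1)] Suc.prems(2) by auto
  moreover have "Ck_extends k (\<lambda>x. frechet_derivative g (at x) b) S" if b: "b \<in> Basis" for b
  proof (rule Suc.IH)
    show "Ck_extends k (\<lambda>x. frechet_derivative f (at x) b) S"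
      using Suc.prems b by simp
    show "frechet_derivative f (at x) b = frechet_derivative g (at x) b" if "x \<in> S" for x
      using frechet_derivative_eq_on_open[OF assms(1) that Suc.prems(1)] by simp
  qed
  ultimately show ?case by simp
qed

text \<open>Any family of derivatives may serve to establish differentiability of order \<open>Suc k\<close>; on an open
  set it coincides with \<^const>\<open>frechet_derivative\<close>.\<close>

lemma Ck_extends_SucI:
  assumes "open S" "continuously_extends f S"
    "\<And>x. x \<in> S \<Longrightarrow> (f has_derivative f' x) (at x)"
    "\<And>b. b \<in> Basis \<Longrightarrow> Ck_extends k (\<lambda>x. f' x b) S"
  shows "Ck_extends (Suc k) f S"
proof -
  have "Ck_extends k (\<lambda>x. frechet_derivative f (at x) b) S" if "b \<in> Basis" for b
    by (rule Ck_extends_cong[OF assms(1) _ assms(4)[OF that]])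
       (simp add: frechet_derivative_at[OF assms(3)])
  moreover have "f differentiable (at x)" if "x \<in> S" for x
    using assms(3)[OF that] unfolding differentiable_def by blast
  ultimately show ?thesis using assms(2) by simp
qed

lemma Ck_extends_has_derivative:
  "Ck_extends (Suc k) f S \<Longrightarrow> x \<in> S \<Longrightarrow> (f has_derivative frechet_derivative f (at x)) (at x)"
  by (simp flip: frechet_derivative_works)

lemma Ck_extends_Suc_imp: "Ck_extends (Suc k) f S \<Longrightarrow> Ck_extends k f S"
proof (induction k arbitrary: f)
  case (Suc k)
  from Suc.prems have "Ck_extends k (\<lambda>x. frechet_derivative f (at x) b) S" if "b \<in> Basis" for b
    using Suc.IH[of "\<lambda>x. frechet_derivative f (at x) b"] that by simp
  then show ?case using Suc.prems by simp
qed simp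

lemma Ck_extends_subset: "Ck_extends k f S \<Longrightarrow> S' \<subseteq> S \<Longrightarrow> Ck_extends k f S'"
  by (induction k arbitrary: f) (auto intro: continuously_extends_subset)

lemma Ck_extends_const: "open S \<Longrightarrow> Ck_extends k (\<lambda>x. c) S"
proof (induction k arbitrary: c)
  case (Suc k)
  show ?case
    by (rule Ck_extends_SucI[where f' = "\<lambda>x h. 0"])
       (use Suc in \<open>auto intro!: continuous_on_closure_imp_continuously_extends\<close>)
qed (auto intro!: continuous_on_closure_imp_continuously_extends)

lemma Ck_extends_add:
  assumes "open S" "Ck_extends k f S" "Ck_extends k g S"
  shows "Ck_extends k (\<lambda>x. f x + g x) S"
  using assms(2,3)
proof (induction k arbitrary: f g)
  case (Suc k)
  show ?case
  proof (rule Ck_extends_SucI[OF assms(1)])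
    show "((\<lambda>x. f x + g x) has_derivative
        (\<lambda>h. frechet_derivative f (at x) h + frechet_derivative g (at x) h)) (at x)"
      if "x \<in> S" for x
      by (intro derivative_intros Ck_extends_has_derivative[OF Suc.prems(1) that]
          Ck_extends_has_derivative[OF Suc.prems(2) that])
  qed (use Suc in \<open>auto intro: continuously_extends_add\<close>)
qed (auto intro: continuously_extends_add)

lemma Ck_extends_sum:
  assumes "open S" "\<And>i. i \<in> I \<Longrightarrow> Ck_extends k (f i) S"
  shows "Ck_extends k (\<lambda>x. \<Sum>i\<in>I. f i x) S"
  using assms(2)
  by (induction I rule: infinite_finite_induct)
     (auto intro: Ck_extends_const[OF assms(1)] Ck_extends_add[OF assms(1)] simp del: Ck_extends.simps)

lemma Ck_extends_bounded_linear:
  assumes "open S" "bounded_linear h" "Ck_extends k f S"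
  shows "Ck_extends k (\<lambda>x. h (f x)) S"
  using assms(3)
proof (induction k arbitrary: f)
  case (Suc k)
  show ?case
  proof (rule Ck_extends_SucI[OF assms(1)])
    show "((\<lambda>x. h (f x)) has_derivative (\<lambda>v. h (frechet_derivative f (at x) v))) (at x)"
      if "x \<in> S" for x
      by (rule bounded_linear.has_derivative[OF assms(2) Ck_extends_has_derivative[OF Suc.prems that]])
  qed (use Suc in \<open>auto intro: continuously_extends_linear[OF assms(2)]\<close>)
qed (auto intro: continuously_extends_linear[OF assms(2)])

lemma Ck_extends_bilinear:
  assumes "open S" "bounded_bilinear pr" "Ck_extends k f S" "Ck_extends k g S"
  shows "Ck_extends k (\<lambda>x. pr (f x) (g x)) S"
  using assms(3,4)
proof (induction k arbitrary: f g)
  case (Suc k)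
  show ?case
  proof (rule Ck_extends_SucI[OF assms(1)])
    show "((\<lambda>x. pr (f x) (g x)) has_derivative
        (\<lambda>h. pr (f x) (frechet_derivative g (at x) h) + pr (frechet_derivative f (at x) h) (g x))) (at x)"
      if "x \<in> S" for x
      by (rule bounded_bilinear.FDERIV[OF assms(2) Ck_extends_has_derivative[OF Suc.prems(1) that]
          Ck_extends_has_derivative[OF Suc.prems(2) that]])
    show "Ck_extends k (\<lambda>x. pr (f x) (frechet_derivative g (at x) b)
        + pr (frechet_derivative f (at x) b) (g x)) S" if "b \<in> Basis" for b
      using Suc.prems that
      by (intro Ck_extends_add[OF assms(1)] Suc.IH Ck_extends_Suc_imp[OF Suc.prems(1)]
          Ck_extends_Suc_imp[OF Suc.prems(2)]) auto
  qed (use Suc in \<open>auto intro: continuously_extends_bilinear[OF assms(2)]\<close>)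
qed (auto intro: continuously_extends_bilinear[OF assms(2)])

lemmas Ck_extends_scaleR = Ck_extends_bilinear[OF _ bounded_bilinear_scaleR]
lemmas Ck_extends_mult = Ck_extends_bilinear[OF _ bounded_bilinear_mult]

lemma Ck_extends_diff:
  assumes "open S" "Ck_extends k f S" "Ck_extends k g S"
  shows "Ck_extends k (\<lambda>x. f x - g x) S"
  using Ck_extends_add[OF assms(1,2) Ck_extends_bounded_linear[OF assms(1)
    bounded_linear_minus[OF bounded_linear_ident] assms(3)]]
  by simp

lemma linear_euclidean_expansion:
  fixes L :: "'a::euclidean_space \<Rightarrow> 'b::real_vector"
  assumes "linear L"
  shows "L v = (\<Sum>b\<in>Basis. (v \<bullet> b) *\<^sub>R L b)"
  using linear_sum[OF assms, of "\<lambda>b. (v \<bullet> b) *\<^sub>R b" Basis]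
  by (simp add: euclidean_representation linear_cmul[OF assms])

lemma Ck_extends_compose:
  fixes f :: "'a::euclidean_space \<Rightarrow> 'b::euclidean_space" and g :: "'b \<Rightarrow> 'c::real_normed_vector"
  assumes "open S" "f ` S \<subseteq> S'" "Ck_extends k f S" "Ck_extends k g S'"
  shows "Ck_extends k (\<lambda>x. g (f x)) S"
  using assms(3,4)
proof (induction k arbitrary: g)
  case 0
  then show ?case using continuously_extends_compose assms(2) by auto
next
  case (Suc k)
  show ?case
  proof (rule Ck_extends_SucI[OF assms(1)])
    show "continuously_extends (\<lambda>x. g (f x)) S"
      using Suc.prems continuously_extends_compose[OF _ _ assms(2)] by auto
    fix x assume x: "x \<in> S"
    let ?Dg = "frechet_derivative g (at (f x))" and ?Df = "frechet_derivative f (at x)"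
    have g: "(g has_derivative ?Dg) (at (f x))"
      using Ck_extends_has_derivative[OF Suc.prems(2)] x assms(2) by blast
    have "((\<lambda>x. g (f x)) has_derivative (\<lambda>h. ?Dg (?Df h))) (at x)"
      using has_derivative_compose[OF Ck_extends_has_derivative[OF Suc.prems(1) x] g] .
    moreover have "?Dg (?Df h) = (\<Sum>c\<in>Basis. (?Df h \<bullet> c) *\<^sub>R ?Dg c)" for h
      by (rule linear_euclidean_expansion[OF has_derivative_linear[OF g]])
    ultimately show "((\<lambda>x. g (f x)) has_derivative (\<lambda>h. \<Sum>c\<in>Basis. (?Df h \<bullet> c) *\<^sub>R ?Dg c)) (at x)"
      by simp
  next
    fix b :: 'a assume b: "b \<in> Basis"
    show "Ck_extends k (\<lambda>x. \<Sum>c\<in>Basis. (frechet_derivative f (at x) b \<bullet> c) *\<^sub>R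
        frechet_derivative g (at (f x)) c) S"
    proof (intro Ck_extends_sum Ck_extends_scaleR assms(1))
      fix c :: 'b assume c: "c \<in> Basis"
      show "Ck_extends k (\<lambda>x. frechet_derivative f (at x) b \<bullet> c) S"
        by (rule Ck_extends_bounded_linear[OF assms(1) bounded_linear_inner_left])
           (use Suc.prems b in auto)
      show "Ck_extends k (\<lambda>x. frechet_derivative g (at (f x)) c) S"
        by (rule Suc.IH[OF Ck_extends_Suc_imp[OF Suc.prems(1)]]) (use Suc.prems c in auto)
    qed
  qed
qed

lemma Ck_on_imp_continuous_on: "Ck_on k f S \<Longrightarrow> continuous_on S f"
  by (cases k) (auto intro!: continuous_at_imp_continuous_on dest: differentiable_imp_continuous_within)

lemma Ck_on_imp_Ck_extends: "Ck_on k f N \<Longrightarrow> closure S \<subseteq> N \<Longrightarrow> Ck_extends k f S"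
proof (induction k arbitrary: f)
  case 0
  then show ?case
    using continuous_on_subset by (auto intro!: continuous_on_closure_imp_continuously_extends)
next
  case (Suc k)
  have "continuously_extends f S"
    using Ck_on_imp_continuous_on[OF Suc.prems(1)] continuous_on_subset[OF _ Suc.prems(2)]
    by (auto intro!: continuous_on_closure_imp_continuously_extends)
  then show ?case using Suc closure_subset[of S] by auto
qed

text \<open>The whole space is its own closure, so the rules for \<^const>\<open>Ck_extends\<close> are also rules for smooth
  functions.\<close>

lemma Ck_on_UNIV_iff: "Ck_on k f UNIV \<longleftrightarrow> Ck_extends k f UNIV"
proof (induction k arbitrary: f)
  case 0
  then show ?case by (auto simp: continuously_extends_def cong: continuous_on_cong)
next
  case (Suc k)
  have "continuously_extends f UNIV" if "\<forall>x. f differentiable (at x)"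
    using that
    by (intro continuous_on_closure_imp_continuously_extends continuous_at_imp_continuous_on)
       (auto dest: differentiable_imp_continuous_within)
  then show ?case using Suc by auto
qed

lemma smooth_iff: "smooth f \<longleftrightarrow> (\<forall>k. Ck_extends k f UNIV)"
  by (simp add: smooth_def Ck_on_UNIV_iff)

lemma smooth_imp_Ck_extends: "smooth f \<Longrightarrow> Ck_extends k f S"
  using smooth_iff Ck_extends_subset by blast

lemma smooth_imp_continuous_on: "smooth f \<Longrightarrow> continuous_on S f"
  using smooth_imp_Ck_extends Ck_extends_continuous_on by blast

lemma smooth_tendsto: "smooth f \<Longrightarrow> (f \<longlongrightarrow> f x) (at x within S)"
  using continuous_on_tendsto_compose[OF smooth_imp_continuous_on[of f UNIV] tendsto_ident_at] by simp

lemma Ck_extends_linear: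
  fixes h :: "'a::euclidean_space \<Rightarrow> 'b::real_normed_vector"
  assumes "open S" "bounded_linear h"
  shows "Ck_extends k h S"
proof (cases k)
  case 0
  then show ?thesis
    using assms by (auto intro!: continuous_on_closure_imp_continuously_extends linear_continuous_on)
next
  case (Suc j)
  then show ?thesis
    using assms
    by (auto simp del: Ck_extends.simps
        intro!: Ck_extends_SucI[where f' = "\<lambda>x. h"] Ck_extends_const bounded_linear.has_derivative
          continuous_on_closure_imp_continuously_extends linear_continuous_on bounded_linear_imp_has_derivative)
qed

lemma smooth_bounded_linear:
  fixes h :: "'a::euclidean_space \<Rightarrow> 'b::real_normed_vector"
  shows "bounded_linear h \<Longrightarrow> smooth h"
  unfolding smooth_iff using Ck_extends_linear by blast

section \<open>Symmetry of second derivatives\<close>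

lemma has_real_derivative_along_line:
  fixes f :: "'a::real_normed_vector \<Rightarrow> real"
  assumes "(f has_derivative D) (at (y + t *\<^sub>R a))"
  shows "((\<lambda>t. f (y + t *\<^sub>R a)) has_real_derivative D a) (at t)"
proof -
  have "((\<lambda>t. y + t *\<^sub>R a) has_derivative (\<lambda>h. h *\<^sub>R a)) (at t)"
    by (auto intro!: derivative_eq_intros)
  from has_derivative_compose[OF this assms]
  have "((\<lambda>t. f (y + t *\<^sub>R a)) has_derivative (\<lambda>h. D (h *\<^sub>R a))) (at t)" .
  then show ?thesis
    by (rule has_derivative_imp_has_field_derivative)
       (simp add: linear_cmul[OF has_derivative_linear[OF assms]])
qed

text \<open>The second difference of \<open>f\<close> over a small parallelogram is a value of the second derivative.\<close>

lemma second_difference: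
  fixes f :: "'a::real_normed_vector \<Rightarrow> real"
  assumes sub: "ball x r \<subseteq> S" and s: "0 < s" "s * (norm a + norm b) < r"
    and f: "\<And>y. y \<in> S \<Longrightarrow> (f has_derivative f' y) (at y)"
    and fa: "\<And>y. y \<in> S \<Longrightarrow> ((\<lambda>y. f' y a) has_derivative f2 y) (at y)"
  obtains \<xi> \<eta> where "0 < \<xi>" "\<xi> < s" "0 < \<eta>" "\<eta> < s"
    "f (x + s *\<^sub>R a + s *\<^sub>R b) - f (x + s *\<^sub>R a) - f (x + s *\<^sub>R b) + f x
      = s * (s * f2 (x + \<xi> *\<^sub>R a + \<eta> *\<^sub>R b) b)"
proof -
  have inS: "x + \<xi> *\<^sub>R a + \<eta> *\<^sub>R b \<in> S" if "0 \<le> \<xi>" "\<xi> \<le> s" "0 \<le> \<eta>" "\<eta> \<le> s" for \<xi> \<eta>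
  proof -
    have "norm (\<xi> *\<^sub>R a + \<eta> *\<^sub>R b) \<le> \<xi> * norm a + \<eta> * norm b"
      using norm_triangle_ineq[of "\<xi> *\<^sub>R a" "\<eta> *\<^sub>R b"] that by simp
    also have "\<dots> \<le> s * norm a + s * norm b"
      using that by (intro add_mono mult_right_mono) auto
    also have "\<dots> < r" using s by (simp add: algebra_simps)
    finally have "dist (x + \<xi> *\<^sub>R a + \<eta> *\<^sub>R b) x < r"
      by (simp add: dist_norm add.assoc)
    then show ?thesis using sub by (auto simp: dist_commute)
  qed
  have "((\<lambda>t. f (x + s *\<^sub>R b + t *\<^sub>R a) - f (x + t *\<^sub>R a)) has_real_derivative
      f' (x + s *\<^sub>R b + t *\<^sub>R a) a - f' (x + t *\<^sub>R a) a) (at t)" if "0 \<le> t" "t \<le> s" for t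
  proof -
    have "x + s *\<^sub>R b + t *\<^sub>R a \<in> S" using inS[of t s] that s by (simp add: add_ac)
    moreover have "x + t *\<^sub>R a \<in> S" using inS[of t 0] that s by simp
    ultimately show ?thesis
      by (intro DERIV_diff has_real_derivative_along_line[OF f])
  qed
  from MVT2[OF s(1) this] obtain \<xi> where \<xi>: "0 < \<xi>" "\<xi> < s"
    and 1: "f (x + s *\<^sub>R b + s *\<^sub>R a) - f (x + s *\<^sub>R a) - (f (x + s *\<^sub>R b + 0 *\<^sub>R a) - f (x + 0 *\<^sub>R a))
       = (s - 0) * (f' (x + s *\<^sub>R b + \<xi> *\<^sub>R a) a - f' (x + \<xi> *\<^sub>R a) a)"
    by auto
  have "((\<lambda>t. f' (x + \<xi> *\<^sub>R a + t *\<^sub>R b) a) has_real_derivative f2 (x + \<xi> *\<^sub>R a + t *\<^sub>R b) b) (at t)"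
    if "0 \<le> t" "t \<le> s" for t
    using inS[of \<xi> t] that \<xi>
      has_real_derivative_along_line[OF fa[of "x + \<xi> *\<^sub>R a + t *\<^sub>R b"]] by simp
  from MVT2[OF s(1) this] obtain \<eta> where \<eta>: "0 < \<eta>" "\<eta> < s"
    and 2: "f' (x + \<xi> *\<^sub>R a + s *\<^sub>R b) a - f' (x + \<xi> *\<^sub>R a + 0 *\<^sub>R b) a
      = (s - 0) * f2 (x + \<xi> *\<^sub>R a + \<eta> *\<^sub>R b) b"
    by auto
  show ?thesis
    using 1 2 by (intro that[OF \<xi> \<eta>]) (simp add: add_ac)
qed

text \<open>The second difference is symmetric in \<open>a\<close> and \<open>b\<close>, so the two mixed derivatives take a common
  value at points arbitrarily near \<open>x\<close>.\<close>

lemma second_derivative_symmetric: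
  fixes f :: "'a::real_normed_vector \<Rightarrow> real"
  assumes "open S" "x \<in> S"
    and f: "\<And>y. y \<in> S \<Longrightarrow> (f has_derivative f' y) (at y)"
    and fa: "\<And>y. y \<in> S \<Longrightarrow> ((\<lambda>y. f' y a) has_derivative fa' y) (at y)"
    and fb: "\<And>y. y \<in> S \<Longrightarrow> ((\<lambda>y. f' y b) has_derivative fb' y) (at y)"
    and ca: "continuous_on S (\<lambda>y. fa' y b)" and cb: "continuous_on S (\<lambda>y. fb' y a)"
  shows "fa' x b = fb' x a"
proof (rule ccontr)
  assume "fa' x b \<noteq> fb' x a"
  then have e: "0 < \<bar>fa' x b - fb' x a\<bar> / 2" (is "0 < ?e") by simp
  obtain r where r: "0 < r" "ball x r \<subseteq> S" using assms(1,2) open_contains_ball by blast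
  obtain d1 where d1: "0 < d1" "\<And>y. y \<in> S \<Longrightarrow> dist y x < d1 \<Longrightarrow> dist (fa' y b) (fa' x b) < ?e"
    using ca e assms(2) unfolding continuous_on_iff by metis
  obtain d2 where d2: "0 < d2" "\<And>y. y \<in> S \<Longrightarrow> dist y x < d2 \<Longrightarrow> dist (fb' y a) (fb' x a) < ?e"
    using cb e assms(2) unfolding continuous_on_iff by metis
  define d where "d = min r (min d1 d2)"
  define s where "s = d / (2 * (norm a + norm b + 1))"
  have d: "0 < d" using r d1 d2 by (simp add: d_def)
  have pos: "0 < norm a + norm b + 1" using norm_ge_zero[of a] norm_ge_zero[of b] by linarith
  have s: "0 < s" using d pos by (simp add: s_def)
  have sd: "s * (norm a + norm b) < d"
  proof -
    have "s * (norm a + norm b) \<le> s * (norm a + norm b + 1)" using s by simp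
    also have "\<dots> = d / 2" using pos by (simp add: s_def field_simps)
    finally show ?thesis using d by simp
  qed
  have near: "dist (x + \<xi> *\<^sub>R a + \<eta> *\<^sub>R b) x < d" if "0 < \<xi>" "\<xi> < s" "0 < \<eta>" "\<eta> < s" for \<xi> \<eta>
  proof -
    have "norm (\<xi> *\<^sub>R a + \<eta> *\<^sub>R b) \<le> \<xi> * norm a + \<eta> * norm b"
      using norm_triangle_ineq[of "\<xi> *\<^sub>R a" "\<eta> *\<^sub>R b"] that by simp
    also have "\<dots> \<le> s * norm a + s * norm b"
      using that by (intro add_mono mult_right_mono) auto
    also have "\<dots> < d" using sd by (simp add: algebra_simps)
    finally show ?thesis by (simp add: dist_norm add.assoc)
  qed
  have inS: "y \<in> S" if "dist y x < d" for y
    using r(2) that by (auto simp: d_def dist_commute)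
  have sr: "s * (norm a + norm b) < r" "s * (norm b + norm a) < r"
    using sd by (auto simp: d_def add.commute)
  obtain \<xi> \<eta> where 1: "0 < \<xi>" "\<xi> < s" "0 < \<eta>" "\<eta> < s"
    "f (x + s *\<^sub>R a + s *\<^sub>R b) - f (x + s *\<^sub>R a) - f (x + s *\<^sub>R b) + f x
      = s * (s * fa' (x + \<xi> *\<^sub>R a + \<eta> *\<^sub>R b) b)"
    using second_difference[OF r(2) s sr(1) f fa] by metis
  obtain \<xi>' \<eta>' where 2: "0 < \<xi>'" "\<xi>' < s" "0 < \<eta>'" "\<eta>' < s"
    "f (x + s *\<^sub>R b + s *\<^sub>R a) - f (x + s *\<^sub>R b) - f (x + s *\<^sub>R a) + f x
      = s * (s * fb' (x + \<xi>' *\<^sub>R b + \<eta>' *\<^sub>R a) a)"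
    using second_difference[OF r(2) s sr(2) f fb] by metis
  let ?p = "x + \<xi> *\<^sub>R a + \<eta> *\<^sub>R b" and ?p' = "x + \<xi>' *\<^sub>R b + \<eta>' *\<^sub>R a"
  have "f (x + s *\<^sub>R b + s *\<^sub>R a) = f (x + s *\<^sub>R a + s *\<^sub>R b)"
    by (simp add: add_ac)
  with 1(5) 2(5) have "s * (s * fa' ?p b) = s * (s * fb' ?p' a)"
    by linarith
  then have eq: "fa' ?p b = fb' ?p' a" using s by simp
  have p: "dist ?p x < d" using near 1 by blast
  have p': "dist ?p' x < d" using near[of \<eta>' \<xi>'] 2 by (simp add: add_ac)
  have "dist (fa' ?p b) (fa' x b) < ?e" using d1(2)[OF inS[OF p]] p by (simp add: d_def)
  moreover have "dist (fb' ?p' a) (fb' x a) < ?e" using d2(2)[OF inS[OF p']] p' by (simp add: d_def)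
  ultimately have "dist (fa' x b) (fb' x a) < \<bar>fa' x b - fb' x a\<bar>"
    unfolding eq by (rule dist_triangle_half_r)
  then show False by (simp add: dist_real_def)
qed


section \<open>Calculus of vector fields\<close>

lemma linear_cart_expansion:
  fixes L :: "real^'n::finite \<Rightarrow> 'b::real_vector"
  assumes "linear L"
  shows "L v = (\<Sum>k\<in>UNIV. v $ k *\<^sub>R L (axis k 1))"
proof -
  have "L (\<Sum>k\<in>UNIV. v $ k *\<^sub>R axis k 1) = (\<Sum>k\<in>UNIV. v $ k *\<^sub>R L (axis k 1))"
    by (simp add: linear_sum[OF assms] linear_cmul[OF assms])
  then show ?thesis
    by (simp only: basis_expansion[of v, unfolded scalar_mult_eq_scaleR])
qed

lemma vf_partials:
  assumes "u differentiable (at x)"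
  shows "vf Y u x = (\<Sum>k\<in>UNIV. Y x $ k * frechet_derivative u (at x) (axis k 1))"
  unfolding vf_def
  using linear_cart_expansion[OF linear_frechet_derivative[OF assms], of "Y x"] by simp

lemma vf_at: "(u has_derivative D) (at x) \<Longrightarrow> vf Y u x = D (Y x)"
  unfolding vf_def by (simp add: frechet_derivative_at[symmetric])

lemma vf_const: "vf Y (\<lambda>_. c) x = 0"
  by (simp add: vf_def)

lemma vf_cong:
  assumes "open S" "x \<in> S" "\<And>y. y \<in> S \<Longrightarrow> f y = g y"
  shows "vf Y f x = vf Y g x"
  unfolding vf_def using frechet_derivative_eq_on_open[OF assms] by simp

lemma Ck_extends_differentiable: "Ck_extends (Suc k) f S \<Longrightarrow> x \<in> S \<Longrightarrow> f differentiable (at x)"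
  by simp

lemma Ck_extends_vec_nth:
  fixes Y :: "'a::euclidean_space \<Rightarrow> real^'n::finite"
  shows "open S \<Longrightarrow> Ck_extends k Y S \<Longrightarrow> Ck_extends k (\<lambda>x. Y x $ i) S"
  by (rule Ck_extends_bounded_linear[OF _ bounded_linear_vec_nth])

lemma Ck_extends_partial:
  "Ck_extends (Suc k) u S \<Longrightarrow> Ck_extends k (\<lambda>x. frechet_derivative u (at x) (axis i 1)) S"
  for u :: "real^'n::finite \<Rightarrow> 'b::real_normed_vector"
  by simp

lemma Ck_extends_vf:
  assumes "open S" "Ck_extends k Y S" "Ck_extends (Suc k) u S"
  shows "Ck_extends k (vf Y u) S"
proof (rule Ck_extends_cong[OF assms(1)])
  show "(\<Sum>k\<in>UNIV. Y x $ k * frechet_derivative u (at x) (axis k 1)) = vf Y u x" if "x \<in> S" for x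
    using vf_partials[OF Ck_extends_differentiable[OF assms(3) that]] by simp
  show "Ck_extends k (\<lambda>x. \<Sum>i\<in>UNIV. Y x $ i * frechet_derivative u (at x) (axis i 1)) S"
    by (intro Ck_extends_sum Ck_extends_mult Ck_extends_vec_nth Ck_extends_partial assms)
qed

lemma vf_mult:
  assumes "f differentiable (at x)" "g differentiable (at x)"
  shows "vf Y (\<lambda>y. f y * g y) x = f x * vf Y g x + vf Y f x * g x"
  using assms vf_at[OF has_derivative_mult[of f _ x UNIV g]]
  by (simp add: frechet_derivative_works vf_def)

lemma vf_sum:
  assumes "\<And>i. i \<in> I \<Longrightarrow> f i differentiable (at x)"
  shows "vf Y (\<lambda>y. \<Sum>i\<in>I. f i y) x = (\<Sum>i\<in>I. vf Y (f i) x)"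
proof -
  have "((\<lambda>y. \<Sum>i\<in>I. f i y) has_derivative (\<lambda>h. \<Sum>i\<in>I. frechet_derivative (f i) (at x) h)) (at x)"
    using assms by (intro has_derivative_sum) (simp flip: frechet_derivative_works)
  from vf_at[OF this] show ?thesis by (simp add: vf_def)
qed

lemma vf_add:
  assumes "f differentiable (at x)" "g differentiable (at x)"
  shows "vf Y (\<lambda>y. f y + g y) x = vf Y f x + vf Y g x"
  using assms vf_at[OF has_derivative_add[of f _ "at x" g]]
  by (simp add: frechet_derivative_works vf_def)

lemma vf_cmult:
  assumes "f differentiable (at x)"
  shows "vf Y (\<lambda>y. c * f y) x = c * vf Y f x"
  using assms vf_mult[of "\<lambda>_. c" x f Y] by (simp add: vf_def)

text \<open>The first summand is the Hessian of \<open>u\<close> applied to \<open>Y\<close> and \<open>Z\<close>; it cancels in commutators.\<close>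

lemma vf_vf:
  assumes "open S" "x \<in> S" "Ck_extends (Suc (Suc 0)) u S" "Z differentiable (at x)"
  shows "vf Y (vf Z u) x =
    (\<Sum>k\<in>UNIV. Z x $ k * (\<Sum>l\<in>UNIV. Y x $ l *
        frechet_derivative (\<lambda>y. frechet_derivative u (at y) (axis k 1)) (at x) (axis l 1)))
    + frechet_derivative u (at x) (frechet_derivative Z (at x) (Y x))"
proof -
  let ?p = "\<lambda>k y. frechet_derivative u (at y) (axis k 1)"
  let ?DZ = "frechet_derivative Z (at x)"
  have p: "?p k differentiable (at x)" for k
    using Ck_extends_differentiable[OF Ck_extends_partial[OF assms(3)] assms(2)] .
  have u: "u differentiable (at x)" by (rule Ck_extends_differentiable[OF assms(3,2)])
  have Z: "((\<lambda>y. Z y $ k) has_derivative (\<lambda>h. ?DZ h $ k)) (at x)" for k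
    using assms(4) by (auto intro!: bounded_linear.has_derivative[OF bounded_linear_vec_nth]
      simp flip: frechet_derivative_works)
  have "vf Y (vf Z u) x = vf Y (\<lambda>y. \<Sum>k\<in>UNIV. Z y $ k * ?p k y) x"
    by (rule vf_cong[OF assms(1,2)])
       (simp add: vf_partials[OF Ck_extends_differentiable[OF assms(3)]])
  also have "\<dots> = (\<Sum>k\<in>UNIV. vf Y (\<lambda>y. Z y $ k * ?p k y) x)"
    using p Z by (intro vf_sum differentiable_mult) (auto simp: differentiable_def)
  also have "\<dots> = (\<Sum>k\<in>UNIV. Z x $ k * vf Y (?p k) x + ?DZ (Y x) $ k * ?p k x)"
  proof (intro sum.cong refl)
    fix k
    show "vf Y (\<lambda>y. Z y $ k * ?p k y) x = Z x $ k * vf Y (?p k) x + ?DZ (Y x) $ k * ?p k x"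
      using vf_mult[of "\<lambda>y. Z y $ k" x "?p k" Y] vf_at[OF Z, of Y k] p Z
      by (auto simp: differentiable_def)
  qed
  also have "\<dots> = (\<Sum>k\<in>UNIV. Z x $ k * vf Y (?p k) x)
      + frechet_derivative u (at x) (?DZ (Y x))"
    using linear_cart_expansion[OF linear_frechet_derivative[OF u], of "?DZ (Y x)"]
    by (simp add: sum.distrib)
  also have "(\<Sum>k\<in>UNIV. Z x $ k * vf Y (?p k) x)
     = (\<Sum>k\<in>UNIV. Z x $ k * (\<Sum>l\<in>UNIV. Y x $ l * frechet_derivative (?p k) (at x) (axis l 1)))"
    by (simp add: vf_partials[OF p])
  finally show ?thesis .
qed

lemma vf_commutator:
  assumes "open S" "x \<in> S" "Ck_extends (Suc (Suc 0)) u S"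
    "Y differentiable (at x)" "Z differentiable (at x)"
  shows "vf Y (vf Z u) x - vf Z (vf Y u) x = vf (lie_bracket Y Z) u x"
proof -
  let ?D = "\<lambda>k l. frechet_derivative (\<lambda>y. frechet_derivative u (at y) (axis k 1)) (at x) (axis l 1)"
  have C1: "Ck_extends (Suc 0) (\<lambda>y. frechet_derivative u (at y) (axis k 1)) S" for k
    using Ck_extends_partial[OF assms(3)] .
  have sym: "?D k l = ?D l k" for k l
    by (rule second_derivative_symmetric[OF assms(1,2) Ck_extends_has_derivative[OF assms(3)]
          Ck_extends_has_derivative[OF C1] Ck_extends_has_derivative[OF C1]])
       (auto intro: Ck_extends_continuous_on Ck_extends_partial[OF C1] simp del: Ck_extends.simps)
  have "(\<Sum>k\<in>UNIV. Z x $ k * (\<Sum>l\<in>UNIV. Y x $ l * ?D k l))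
      = (\<Sum>k\<in>UNIV. \<Sum>l\<in>UNIV. Y x $ l * (Z x $ k * ?D l k))"
    by (simp add: sum_distrib_left sym mult_ac)
  also have "\<dots> = (\<Sum>k\<in>UNIV. Y x $ k * (\<Sum>l\<in>UNIV. Z x $ l * ?D k l))"
    by (subst sum.swap) (simp add: sum_distrib_left)
  finally show ?thesis
    using linear_diff[OF linear_frechet_derivative[OF Ck_extends_differentiable[OF assms(3,2)]]]
    by (simp add: vf_vf[OF assms(1-3,5)] vf_vf[OF assms(1-3,4)] vf_def[of "lie_bracket Y Z"] lie_bracket_def)
qed

lemma divergence_at: "(V has_derivative D) (at x) \<Longrightarrow> divergence V x = (\<Sum>k\<in>UNIV. D (axis k 1) $ k)"
  unfolding divergence_def by (simp add: frechet_derivative_at[symmetric])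

lemma divergence_scaleR:
  assumes "\<phi> differentiable (at x)" "Y differentiable (at x)"
  shows "divergence (\<lambda>y. \<phi> y *\<^sub>R Y y) x = vf Y \<phi> x + \<phi> x * divergence Y x"
proof -
  have "((\<lambda>y. \<phi> y *\<^sub>R Y y) has_derivative (\<lambda>h. \<phi> x *\<^sub>R frechet_derivative Y (at x) h
      + frechet_derivative \<phi> (at x) h *\<^sub>R Y x)) (at x)"
    using assms by (auto intro!: has_derivative_scaleR simp: frechet_derivative_works)
  from divergence_at[OF this] show ?thesis
    by (simp add: vf_partials[OF assms(1)] divergence_def sum.distrib sum_distrib_left mult_ac)
qed

lemma divergence_add:
  assumes "V differentiable (at x)" "W differentiable (at x)"
  shows "divergence (\<lambda>y. V y + W y) x = divergence V x + divergence W x"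
  using assms divergence_at[OF has_derivative_add[of V _ "at x" W]]
  by (simp add: frechet_derivative_works divergence_def sum.distrib)

lemma divergence_sum:
  assumes "\<And>i. i \<in> I \<Longrightarrow> V i differentiable (at x)"
  shows "divergence (\<lambda>y. \<Sum>i\<in>I. V i y) x = (\<Sum>i\<in>I. divergence (V i) x)"
proof -
  have "((\<lambda>y. \<Sum>i\<in>I. V i y) has_derivative (\<lambda>h. \<Sum>i\<in>I. frechet_derivative (V i) (at x) h)) (at x)"
    using assms by (intro has_derivative_sum) (simp flip: frechet_derivative_works)
  from divergence_at[OF this] show ?thesis
    unfolding divergence_def sum_component by (simp add: sum.swap[of _ I])
qed

lemma divergence_cong:
  assumes "open S" "x \<in> S" "\<And>y. y \<in> S \<Longrightarrow> V y = W y"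
  shows "divergence V x = divergence W x"
  unfolding divergence_def using frechet_derivative_eq_on_open[OF assms] by simp


section \<open>Homogeneous vector fields\<close>

lemma dil_linear: "linear (dil \<sigma> l)"
  by (rule linearI) (simp_all add: dil_def vec_eq_iff algebra_simps)

lemma dil_bounded_linear: "bounded_linear (dil \<sigma> l)"
  using dil_linear linear_conv_bounded_linear by blast

lemma euler_field_linear: "linear (euler_field \<sigma>)"
  by (rule linearI) (simp_all add: euler_field_def vec_eq_iff algebra_simps)

lemma euler_field_bounded_linear: "bounded_linear (euler_field \<sigma>)"
  using euler_field_linear linear_conv_bounded_linear by blast

text \<open>Testing homogeneity on the coordinate functions gives the transformation rule of the
  coefficients.\<close>

lemma homogeneous_field_dil:
  assumes "homogeneous_field \<sigma> Y" "0 < l"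
  shows "dil \<sigma> l (Y x) = l *\<^sub>R Y (dil \<sigma> l x)"
proof -
  have "(dil \<sigma> l (Y x)) $ k = l * Y (dil \<sigma> l x) $ k" for k
  proof -
    let ?u = "\<lambda>x. x $ k :: real"
    have bl: "bounded_linear (?u \<circ> dil \<sigma> l)"
      unfolding o_def using bounded_linear_compose[OF bounded_linear_vec_nth dil_bounded_linear] .
    have "vf Y (?u \<circ> dil \<sigma> l) x = l * vf Y ?u (dil \<sigma> l x)"
      using assms smooth_bounded_linear[OF bounded_linear_vec_nth] unfolding homogeneous_field_def by blast
    moreover have "vf Y (?u \<circ> dil \<sigma> l) x = dil \<sigma> l (Y x) $ k"
      using vf_at[OF bounded_linear_imp_has_derivative[OF bl]] by simp
    moreover have "vf Y ?u (dil \<sigma> l x) = Y (dil \<sigma> l x) $ k"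
      using vf_at[OF bounded_linear_imp_has_derivative[OF bounded_linear_vec_nth]] .
    ultimately show ?thesis by simp
  qed
  then show ?thesis by (simp add: vec_eq_iff)
qed

lemma dil_has_derivative_at_1: "((\<lambda>l. dil \<sigma> l x) has_derivative (\<lambda>h. h *\<^sub>R euler_field \<sigma> x)) (at 1)"
proof -
  have "((\<lambda>l. l ^ \<sigma> k * x $ k) has_derivative (\<lambda>h. h * (real (\<sigma> k) * x $ k))) (at 1)" for k
    by (auto intro!: derivative_eq_intros)
  then show ?thesis
    by (subst has_derivative_componentwise_within)
       (auto simp: Basis_vec_def dil_def euler_field_def inner_axis)
qed

lemma dil_1: "dil \<sigma> 1 x = x"
  by (simp add: dil_def)

text \<open>The derivative at \<open>l = 1\<close> of the rule \<open>dil \<sigma> l (Y x) = l Y (dil \<sigma> l x)\<close>.\<close>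

lemma homogeneous_field_euler:
  assumes "homogeneous_field \<sigma> Y" "Y differentiable (at x)"
  shows "frechet_derivative Y (at x) (euler_field \<sigma> x) = euler_field \<sigma> (Y x) - Y x"
proof -
  let ?D = "frechet_derivative Y (at x)"
  have D: "(Y has_derivative ?D) (at (dil \<sigma> 1 x))"
    using assms(2) by (simp add: dil_1 flip: frechet_derivative_works)
  have "((\<lambda>l. l *\<^sub>R Y (dil \<sigma> l x)) has_derivative
      (\<lambda>h. 1 *\<^sub>R ?D (h *\<^sub>R euler_field \<sigma> x) + h *\<^sub>R Y (dil \<sigma> 1 x))) (at 1)"
    by (rule has_derivative_scaleR[OF has_derivative_ident
        has_derivative_compose[OF dil_has_derivative_at_1 D]])
  then have "((\<lambda>l. dil \<sigma> l (Y x)) has_derivative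
      (\<lambda>h. 1 *\<^sub>R ?D (h *\<^sub>R euler_field \<sigma> x) + h *\<^sub>R Y (dil \<sigma> 1 x))) (at 1)"
    by (rule has_derivative_transform_within_open[where s = "{0<..}"])
       (auto simp: homogeneous_field_dil[OF assms(1)])
  from fun_cong[OF has_derivative_unique[OF this dil_has_derivative_at_1], of 1]
  have "?D (euler_field \<sigma> x) + Y x = euler_field \<sigma> (Y x)"
    by (simp add: dil_1)
  then show ?thesis by (simp add: algebra_simps)
qed

lemma euler_field_frechet_derivative: "frechet_derivative (euler_field \<sigma>) (at x) = euler_field \<sigma>"
  by (metis bounded_linear_imp_has_derivative euler_field_bounded_linear frechet_derivative_at)

lemma lie_bracket_euler_field:
  assumes "homogeneous_field \<sigma> Y" "Y differentiable (at x)"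
  shows "lie_bracket Y (euler_field \<sigma>) x = Y x"
  by (simp add: lie_bracket_def euler_field_frechet_derivative homogeneous_field_euler[OF assms])

lemma divergence_euler_field: "divergence (euler_field \<sigma>) x = real (hom_dim \<sigma>)"
  by (simp add: divergence_def euler_field_frechet_derivative hom_dim_def euler_field_def)

lemma dil_axis: "dil \<sigma> l (axis k 1) = l ^ \<sigma> k *\<^sub>R axis k 1"
  by (simp add: dil_def vec_eq_iff axis_def)

lemma dil_tendsto: "((\<lambda>l. dil \<sigma> l x) \<longlongrightarrow> dil \<sigma> 0 x) (at_right 0)"
  unfolding dil_def by (intro tendsto_intros tendsto_vec_lambda)

text \<open>Each diagonal derivative \<open>\<partial>_k Y_k\<close> is homogeneous of degree \<open>-1\<close> and continuous at the origin,
  hence zero.\<close>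

lemma divergence_homogeneous_field:
  assumes "homogeneous_field \<sigma> Y" "smooth Y"
  shows "divergence Y x = 0"
proof -
  have Y: "Ck_extends (Suc 0) Y UNIV" using assms(2) smooth_iff by blast
  have D: "(Y has_derivative frechet_derivative Y (at x)) (at x)" for x
    using Ck_extends_has_derivative[OF Y] by simp
  have "frechet_derivative Y (at x) (axis k 1) $ k = 0" for k
  proof -
    define p where "p x = frechet_derivative Y (at x) (axis k 1) $ k" for x
    have scal: "l * p (dil \<sigma> l x) = p x" if l: "0 < l" for l
    proof -
      have "((\<lambda>x. l *\<^sub>R Y (dil \<sigma> l x)) has_derivative
          (\<lambda>h. l *\<^sub>R frechet_derivative Y (at (dil \<sigma> l x)) (dil \<sigma> l h))) (at x)"
        by (intro has_derivative_scaleR_right has_derivative_compose[OF _ D]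
            bounded_linear_imp_has_derivative dil_bounded_linear)
      then have "((\<lambda>x. dil \<sigma> l (Y x)) has_derivative
          (\<lambda>h. l *\<^sub>R frechet_derivative Y (at (dil \<sigma> l x)) (dil \<sigma> l h))) (at x)"
        by (simp add: homogeneous_field_dil[OF assms(1) l])
      from fun_cong[OF has_derivative_unique[OF this bounded_linear.has_derivative[OF dil_bounded_linear D]],
          of "axis k 1"]
      have "l *\<^sub>R frechet_derivative Y (at (dil \<sigma> l x)) (dil \<sigma> l (axis k 1))
          = dil \<sigma> l (frechet_derivative Y (at x) (axis k 1))" .
      then have "l *\<^sub>R (l ^ \<sigma> k *\<^sub>R frechet_derivative Y (at (dil \<sigma> l x)) (axis k 1))
          = dil \<sigma> l (frechet_derivative Y (at x) (axis k 1))"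
        by (simp add: dil_axis linear_cmul[OF has_derivative_linear[OF D]])
      from arg_cong[OF this, of "\<lambda>v. v $ k"]
      have "l * (l ^ \<sigma> k * p (dil \<sigma> l x)) = l ^ \<sigma> k * p x"
        by (simp add: p_def dil_def)
      then show ?thesis using l by simp
    qed
    have "continuous_on UNIV p"
      unfolding p_def
      using Ck_extends_continuous_on[OF Ck_extends_vec_nth[OF open_UNIV Ck_extends_partial[OF Y]]] .
    then have "((\<lambda>l. l * p (dil \<sigma> l x)) \<longlongrightarrow> 0 * p (dil \<sigma> 0 x)) (at_right 0)"
      by (intro tendsto_mult tendsto_ident_at continuous_on_tendsto_compose[OF _ dil_tendsto]) auto
    moreover have "eventually (\<lambda>l. l * p (dil \<sigma> l x) = p x) (at_right 0)"
      using eventually_at_right_less by (rule eventually_mono) (rule scal)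
    ultimately have "((\<lambda>l::real. p x) \<longlongrightarrow> 0 * p (dil \<sigma> 0 x)) (at_right 0)"
      by (rule Lim_transform_eventually)
    then show ?thesis by (simp add: tendsto_const_iff flip: p_def)
  qed
  then show ?thesis by (simp add: divergence_def)
qed

section \<open>Hormander's condition away from the origin\<close>

lemma smooth_lie_bracket:
  assumes "smooth Y" "smooth Z"
  shows "smooth (lie_bracket Y Z)"
  unfolding smooth_iff
proof
  fix k
  have D: "Ck_extends k (\<lambda>x. frechet_derivative V (at x) (U x)) UNIV"
    if "smooth U" "smooth V" for U V :: "real^'a::finite \<Rightarrow> real^'a"
  proof (rule Ck_extends_cong[OF open_UNIV])
    have U: "Ck_extends k U UNIV" and V: "Ck_extends (Suc k) V UNIV"
      using that unfolding smooth_iff by blast+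
    show "Ck_extends k (\<lambda>x. \<Sum>i\<in>UNIV. U x $ i *\<^sub>R frechet_derivative V (at x) (axis i 1)) UNIV"
      by (intro Ck_extends_sum Ck_extends_scaleR Ck_extends_vec_nth Ck_extends_partial open_UNIV U V)
    show "(\<Sum>i\<in>UNIV. U x $ i *\<^sub>R frechet_derivative V (at x) (axis i 1))
        = frechet_derivative V (at x) (U x)" for x
      by (rule linear_cart_expansion[OF linear_frechet_derivative[OF Ck_extends_differentiable[OF V]],
            symmetric]) simp
  qed
  show "Ck_extends k (lie_bracket Y Z) UNIV"
    unfolding lie_bracket_def by (intro Ck_extends_diff open_UNIV D assms)
qed

lemma smooth_zero: "smooth (\<lambda>x. 0)"
  unfolding smooth_iff by (simp add: Ck_extends_const del: Ck_extends.simps)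

lemma smooth_lie_algebra:
  assumes "\<And>i. smooth (X i)" "Y \<in> lie_algebra X"
  shows "smooth Y"
  using assms(2)
proof induction
  case (add Y Z)
  then show ?case unfolding smooth_iff by (blast intro: Ck_extends_add)
next
  case (scale Y c)
  then show ?case
    unfolding smooth_iff using Ck_extends_bounded_linear[OF _ bounded_linear_scaleR_right] by blast
qed (simp_all add: assms(1) smooth_lie_bracket smooth_zero)

lemma smooth_imp_differentiable: "smooth f \<Longrightarrow> f differentiable (at x)"
  using Ck_extends_differentiable[of 0 f UNIV x] unfolding smooth_iff by blast

text \<open>A function annihilated by the generators is annihilated by every commutator, because
  \<open>[Y, Z] u = Y (Z u) - Z (Y u)\<close>.\<close>

lemma lie_algebra_annihilates:
  assumes "\<And>i. smooth (X i)" "open W" "Ck_extends (Suc (Suc 0)) u W"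
    and X0: "\<And>i x. x \<in> W \<Longrightarrow> vf (X i) u x = 0"
    and "Y \<in> lie_algebra X" "x \<in> W"
  shows "vf Y u x = 0"
  using assms(5,6)
proof (induction arbitrary: x)
  case (generator i)
  then show ?case using X0 by simp
next
  case zero
  then show ?case
    using linear_0[OF linear_frechet_derivative[OF Ck_extends_differentiable[OF assms(3)]]]
    by (simp add: vf_def)
next
  case (add Y Z)
  then show ?case
    using linear_add[OF linear_frechet_derivative[OF Ck_extends_differentiable[OF assms(3) add.prems]]]
    by (simp add: vf_def)
next
  case (scale Y c)
  then show ?case
    using linear_cmul[OF linear_frechet_derivative[OF Ck_extends_differentiable[OF assms(3) scale.prems]]]
    by (simp add: vf_def)
next
  case (bracket Y Z)
  have "vf V (vf U u) x = 0" if "\<And>y. y \<in> W \<Longrightarrow> vf U u y = 0" for U V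
  proof -
    have "vf V (vf U u) x = vf V (\<lambda>_. 0) x"
      by (rule vf_cong[OF assms(2) bracket.prems]) (rule that)
    then show ?thesis by (simp add: vf_const)
  qed
  then have "vf Y (vf Z u) x = 0" "vf Z (vf Y u) x = 0"
    using bracket.IH by blast+
  then show ?case
    using vf_commutator[OF assms(2) bracket.prems assms(3)
        smooth_imp_differentiable[OF smooth_lie_algebra[OF assms(1) bracket.hyps(1)]]
        smooth_imp_differentiable[OF smooth_lie_algebra[OF assms(1) bracket.hyps(2)]]]
    by simp
qed

lemma dil_dil_inverse:
  assumes "0 < l"
  shows "dil \<sigma> (1 / l) (dil \<sigma> l x) = x" "dil \<sigma> l (dil \<sigma> (1 / l) x) = x"
  using assms by (simp_all add: dil_def vec_eq_iff power_one_over)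

text \<open>The Lie algebra is invariant under push-forward by dilations.\<close>

lemma lie_algebra_pushforward:
  assumes "\<And>i. smooth (X i)" "\<And>i. homogeneous_field \<sigma> (X i)" "0 < l" "Y \<in> lie_algebra X"
  shows "(\<lambda>x. dil \<sigma> l (Y (dil \<sigma> (1 / l) x))) \<in> lie_algebra X"
  using assms(4)
proof induction
  case (generator i)
  have "(\<lambda>x. dil \<sigma> l (X i (dil \<sigma> (1 / l) x))) = (\<lambda>x. l *\<^sub>R X i x)"
    using assms(3) by (simp add: homogeneous_field_dil[OF assms(2,3)] dil_dil_inverse)
  then show ?case by (simp add: lie_algebra.intros)
next
  case zero
  then show ?case by (simp add: linear_0[OF dil_linear] lie_algebra.zero)
next
  case (add Y Z)
  then show ?case using lie_algebra.add by (simp add: linear_add[OF dil_linear])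
next
  case (scale Y c)
  then show ?case using lie_algebra.scale by (simp add: linear_cmul[OF dil_linear])
next
  case (bracket Y Z)
  let ?P = "\<lambda>Y x. dil \<sigma> l (Y (dil \<sigma> (1 / l) x))"
  have D: "frechet_derivative (?P U) (at x) h
      = dil \<sigma> l (frechet_derivative U (at (dil \<sigma> (1 / l) x)) (dil \<sigma> (1 / l) h))"
    if U: "U \<in> lie_algebra X" for U x h
  proof -
    have "(U has_derivative frechet_derivative U (at y)) (at y)" for y
      using smooth_imp_differentiable[OF smooth_lie_algebra[OF assms(1) U]]
      by (simp flip: frechet_derivative_works)
    then have "(?P U has_derivative
        (\<lambda>h. dil \<sigma> l (frechet_derivative U (at (dil \<sigma> (1 / l) x)) (dil \<sigma> (1 / l) h)))) (at x)"
      by (intro bounded_linear.has_derivative[OF dil_bounded_linear]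
          has_derivative_compose[OF bounded_linear_imp_has_derivative[OF dil_bounded_linear]])
    then show ?thesis by (simp add: frechet_derivative_at[symmetric])
  qed
  have "lie_bracket (?P Y) (?P Z) = ?P (lie_bracket Y Z)"
    by (rule ext)
       (simp add: lie_bracket_def D bracket.hyps dil_dil_inverse[OF assms(3)] linear_diff[OF dil_linear])
  then show ?case using lie_algebra.bracket[OF bracket.IH] by simp
qed

lemma inner_dil: "x \<bullet> dil \<sigma> l y = dil \<sigma> l x \<bullet> y"
  by (simp add: dil_def inner_vec_def mult_ac)

text \<open>A covector annihilating the Lie algebra at \<open>x\<close> is transported by dilations to the points
  \<open>dil \<sigma> \<epsilon> x\<close>; a limit of the normalised covectors as \<open>\<epsilon>\<close> tends to \<open>0\<close> annihilates the Lie algebra at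
  the origin, which Hormander's condition there forbids.\<close>

lemma hormander_everywhere:
  fixes X :: "'m \<Rightarrow> real^'n::finite \<Rightarrow> real^'n"
  assumes smooth: "\<And>i. smooth (X i)" and hom: "\<And>i. homogeneous_field \<sigma> (X i)"
    and H: "hormander_at_0 X" and \<sigma>: "\<And>k. 0 < \<sigma> k"
    and v: "\<And>Y. Y \<in> lie_algebra X \<Longrightarrow> v \<bullet> Y x = 0"
  shows "v = 0"
proof (rule ccontr)
  assume "v \<noteq> 0"
  define e where "e j = 1 / real (Suc j)" for j
  have e: "0 < e j" for j by (simp add: e_def)
  have e0: "e \<longlonglongrightarrow> 0"
    unfolding e_def using LIMSEQ_inverse_real_of_nat by (simp add: inverse_eq_divide)
  define w where "w j = dil \<sigma> (1 / e j) v" for j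
  have w0: "w j \<noteq> 0" for j
    using \<open>v \<noteq> 0\<close> dil_dil_inverse(2)[OF e, of \<sigma> j v] linear_0[OF dil_linear] unfolding w_def by metis
  have w: "w j \<bullet> Y (dil \<sigma> (e j) x) = 0" if "Y \<in> lie_algebra X" for j Y
    using v[OF lie_algebra_pushforward[OF smooth hom _ that, of "1 / e j"]] e[of j]
    by (simp add: w_def inner_dil)
  define n where "n j = w j /\<^sub>R norm (w j)" for j
  have n: "n j \<in> sphere 0 1" for j using w0[of j] by (simp add: n_def)
  obtain l r where l: "l \<in> sphere 0 1" and r: "strict_mono r" and lim: "(n \<circ> r) \<longlonglongrightarrow> l"
    using compact_sphere[of "0::real^'n" 1] n unfolding compact_def by metis
  have "(\<lambda>j. dil \<sigma> (e j) x) \<longlonglongrightarrow> 0"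
  proof (rule vec_tendstoI)
    fix k
    have "(\<lambda>j. e j ^ \<sigma> k * x $ k) \<longlonglongrightarrow> 0 ^ \<sigma> k * x $ k"
      by (intro tendsto_intros e0)
    then show "(\<lambda>j. dil \<sigma> (e j) x $ k) \<longlonglongrightarrow> 0 $ k"
      using \<sigma>[of k] by (simp add: dil_def zero_power)
  qed
  from LIMSEQ_subseq_LIMSEQ[OF this r] have d: "(\<lambda>j. dil \<sigma> (e (r j)) x) \<longlonglongrightarrow> 0"
    by (simp add: o_def)
  have l0: "l \<bullet> Y 0 = 0" if Y: "Y \<in> lie_algebra X" for Y
  proof -
    from continuous_on_tendsto_compose[OF smooth_imp_continuous_on[OF smooth_lie_algebra[OF smooth Y]] d, of UNIV]
    have "(\<lambda>j. Y (dil \<sigma> (e (r j)) x)) \<longlonglongrightarrow> Y 0" by simp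
    from tendsto_inner[OF lim[unfolded o_def] this]
    have "(\<lambda>j. n (r j) \<bullet> Y (dil \<sigma> (e (r j)) x)) \<longlonglongrightarrow> l \<bullet> Y 0" .
    moreover have "n j \<bullet> Y (dil \<sigma> (e j) x) = 0" for j
      using w[OF Y] by (simp add: n_def)
    ultimately show ?thesis by (simp add: LIMSEQ_const_iff)
  qed
  have "span {Y 0 |Y. Y \<in> lie_algebra X} = UNIV"
    using H unfolding hormander_at_0_def by (simp flip: dim_eq_full)
  then have "l \<in> span {Y 0 |Y. Y \<in> lie_algebra X}" by simp
  then have "l \<bullet> l = 0"
    by (rule span_induct[where P = "\<lambda>y. l \<bullet> y = 0"])
       (auto simp: l0 subspace_def inner_add_right)
  then show False using l by simp
qed

lemma X_gradient_zero_imp_derivative_zero: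
  fixes X :: "'m::finite \<Rightarrow> real^'n::finite \<Rightarrow> real^'n"
  assumes "\<And>i. smooth (X i)" "\<And>i. homogeneous_field \<sigma> (X i)"
    and "hormander_at_0 X" "\<And>k. 0 < \<sigma> k"
    and W: "open W" "Ck_extends (Suc (Suc 0)) u W" "\<And>i x. x \<in> W \<Longrightarrow> vf (X i) u x = 0" "x \<in> W"
  shows "(u has_derivative (\<lambda>h. 0)) (at x)"
proof -
  let ?D = "frechet_derivative u (at x)"
  have u: "u differentiable (at x)" by (rule Ck_extends_differentiable[OF W(2,4)])
  define v where "v = (\<chi> k. ?D (axis k 1))"
  have D: "?D h = v \<bullet> h" for h
    using linear_cart_expansion[OF linear_frechet_derivative[OF u], of h]
    by (simp add: v_def inner_vec_def mult_ac)
  have "v = 0"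
  proof (rule hormander_everywhere[OF assms(1-4)])
    show "v \<bullet> Y x = 0" if "Y \<in> lie_algebra X" for Y
      using lie_algebra_annihilates[OF assms(1) W(1-3) that W(4)] by (simp add: vf_def D)
  qed
  then have "?D = (\<lambda>h. 0)" using D by auto
  then show ?thesis using u frechet_derivative_works by metis
qed


section \<open>Unique continuation\<close>

lemma critical_point_of_zero_boundary_values:
  fixes u :: "'a::euclidean_space \<Rightarrow> real"
  assumes "open C" "bounded C" "continuous_on (closure C) u" "\<And>x. x \<in> frontier C \<Longrightarrow> u x = 0"
    "\<And>x. x \<in> C \<Longrightarrow> (u has_derivative u' x) (at x)" "x0 \<in> C" "u x0 \<noteq> 0"
  obtains y where "y \<in> C" "u' y = (\<lambda>h. 0)"
proof -
  have x0: "x0 \<in> closure C" using closure_subset assms(6) by (rule subsetD)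
  have "\<exists>y\<in>closure C. \<forall>z\<in>closure C. \<bar>u z\<bar> \<le> \<bar>u y\<bar>"
    using assms(2,3) x0 by (intro continuous_attains_sup continuous_intros) auto
  then obtain y where y: "y \<in> closure C" "\<And>z. z \<in> closure C \<Longrightarrow> \<bar>u z\<bar> \<le> \<bar>u y\<bar>"
    by auto
  have "u y \<noteq> 0" using y(2)[OF x0] assms(7) by auto
  then have "y \<notin> frontier C" using assms(4) by blast
  then have yC: "y \<in> C"
    using y(1) assms(1) by (simp add: frontier_def interior_open)
  have *: "\<bar>u z\<bar> \<le> \<bar>u y\<bar>" if "z \<in> C" for z
    by (rule y(2)) (rule subsetD[OF closure_subset that])
  have "(\<forall>z\<in>C. u z \<le> u y) \<or> (\<forall>z\<in>C. u y \<le> u z)"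
  proof (cases "0 \<le> u y")
    case True
    have "u z \<le> u y" if "z \<in> C" for z using *[OF that] True by linarith
    then show ?thesis by blast
  next
    case False
    have "u y \<le> u z" if "z \<in> C" for z using *[OF that] False by linarith
    then show ?thesis by blast
  qed
  from differential_zero_maxmin[OF yC assms(1) assms(5)[OF yC] this]
  show ?thesis by (rule that[OF yC])
qed

lemma open_component_properties:
  fixes W :: "'a::euclidean_space set"
  assumes "open W" "x \<in> W"
  defines "C \<equiv> connected_component_set W x"
  shows "open C" "connected C" "C \<subseteq> W" "x \<in> C" "\<And>y. y \<in> frontier C \<Longrightarrow> y \<in> closure W - W"
proof -
  show "open C" unfolding C_def by (rule open_connected_component[OF assms(1)])
  show "connected C" unfolding C_def by (rule connected_connected_component)
  show "C \<subseteq> W" unfolding C_def by (rule connected_component_subset)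
  show "x \<in> C" unfolding C_def using assms(2) by simp
  show "y \<in> closure W - W" if "y \<in> frontier C" for y
    using that frontier_of_connected_component_subset[of W x] assms(1)
    by (auto simp: C_def frontier_def interior_open)
qed

text \<open>On a component \<open>C\<close> of the open set where neither \<open>u\<close> nor the \<open>X\<close>-gradient vanishes, the \<open>X\<close>-Hessian
  vanishes, so each \<open>X_i u\<close> is a constant, and one of them is not zero. Then \<open>u = 0\<close> on the frontier of
  \<open>C\<close>, although \<open>u\<close> has no critical point in \<open>C\<close>; this is impossible. So the \<open>X\<close>-gradient vanishes wherever
  \<open>u\<close> does not, and \<open>u\<close> is a non-zero constant on every component of \<open>u \<noteq> 0\<close>, contradicting its
  frontier values.\<close>

lemma vanishing_product_imp_zero:
  fixes X :: "'m::finite \<Rightarrow> real^'n::finite \<Rightarrow> real^'n" and u :: "real^'n \<Rightarrow> real"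
  assumes X: "\<And>i. smooth (X i)" "\<And>i. homogeneous_field \<sigma> (X i)"
      "hormander_at_0 X" "\<And>k. 0 < \<sigma> k"
    and \<Omega>: "open \<Omega>" "bounded \<Omega>"
    and u: "continuous_on (closure \<Omega>) u" "Ck_extends 3 u \<Omega>" "\<And>x. x \<in> frontier \<Omega> \<Longrightarrow> u x = 0"
    and prod0: "\<And>x. x \<in> \<Omega> \<Longrightarrow> u x = 0 \<or> X_grad X u x = 0 \<or> X_hess X u x = 0"
    and "x \<in> \<Omega>"
  shows "u x = 0"
proof -
  define w where "w i = vf (X i) u" for i
  have u3: "Ck_extends (Suc (Suc (Suc 0))) u \<Omega>" using u(2) by (simp add: numeral_3_eq_3)
  have u2: "Ck_extends (Suc (Suc 0)) u \<Omega>" using Ck_extends_Suc_imp[OF u3] .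
  have w2: "Ck_extends (Suc (Suc 0)) (w i) \<Omega>" for i
    unfolding w_def by (rule Ck_extends_vf[OF \<Omega>(1) smooth_imp_Ck_extends[OF X(1)] u3])
  have grad: "X_grad X u x = 0 \<longleftrightarrow> (\<forall>i. w i x = 0)" for x
    by (simp add: X_grad_def w_def vec_eq_iff)
  have hess: "X_hess X u x = 0 \<longleftrightarrow> (\<forall>i j. vf (X j) (w i) x = 0)" for x
    by (simp add: X_hess_def w_def vec_eq_iff)
  have closure_cases: "y \<in> \<Omega> \<or> u y = 0" if "y \<in> closure \<Omega>" for y
    using that u(3) \<Omega>(1) by (auto simp: frontier_def interior_open)
  have open_ne: "open {x \<in> \<Omega>. f x \<noteq> 0}" if "Ck_extends k f \<Omega>" for k and f :: "real^'n \<Rightarrow> real"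
    using continuous_open_preimage[OF Ck_extends_continuous_on[OF that] \<Omega>(1), of "- {0}"]
    by (simp add: vimage_def Int_def open_Compl)
  define W where "W = {x \<in> \<Omega>. u x \<noteq> 0 \<and> (\<exists>i. w i x \<noteq> 0)}"
  have "W = {x \<in> \<Omega>. u x \<noteq> 0} \<inter> (\<Union>i. {x \<in> \<Omega>. w i x \<noteq> 0})" unfolding W_def by auto
  then have oW: "open W" using open_ne[OF u2] open_ne[OF w2] by auto
  have W\<Omega>: "W \<subseteq> \<Omega>" by (auto simp: W_def)
  have "W = {}"
  proof (rule ccontr)
    assume "W \<noteq> {}"
    then obtain x0 where x0: "x0 \<in> W" by blast
    define C where "C = connected_component_set W x0"
    note C = open_component_properties[OF oW x0, folded C_def]
    have C\<Omega>: "C \<subseteq> \<Omega>" using C(3) W\<Omega> by blast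
    have cC: "closure C \<subseteq> closure \<Omega>" using C\<Omega> by (rule closure_mono)
    obtain i where i: "w i x0 \<noteq> 0" using x0 by (auto simp: W_def)
    have "(w i has_derivative (\<lambda>h. 0)) (at x)" if "x \<in> W" for x
    proof (rule X_gradient_zero_imp_derivative_zero[OF X oW _ _ that])
      show "Ck_extends (Suc (Suc 0)) (w i) W" using Ck_extends_subset[OF w2 W\<Omega>] .
      show "vf (X j) (w i) x = 0" if "x \<in> W" for j x
        using prod0[of x] that unfolding W_def grad hess by auto
    qed
    then have const: "w i x = w i x0" if "x \<in> C" for x
      using has_derivative_zero_unique_connected[OF C(1,2) _ that C(4)] C(3) by blast
    \<comment> \<open>The constancy of \<open>w i\<close> is carried to the frontier of \<open>C\<close> by its extension to the closure of \<open>\<Omega>\<close>.\<close>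
    obtain g where g: "continuous_on (closure \<Omega>) g" "\<And>x. x \<in> \<Omega> \<Longrightarrow> g x = w i x"
      using Ck_extends_imp_continuously_extends[OF w2] unfolding continuously_extends_def by blast
    have gC: "g y = w i x0" if "y \<in> closure C" for y
      by (rule continuous_constant_on_closure[OF continuous_on_subset[OF g(1) cC] _ that])
         (use const g(2) C\<Omega> in auto)
    have fr: "u y = 0" if y: "y \<in> frontier C" for y
    proof -
      have yc: "y \<in> closure C" using y by (simp add: frontier_def)
      show ?thesis
      proof (cases "y \<in> \<Omega>")
        case True
        then have "w i y \<noteq> 0" using gC[OF yc] g(2) i by simp
        then show ?thesis using C(5)[OF y] True unfolding W_def by blast
      next
        case False
        then show ?thesis using closure_cases yc cC by blast
      qed
    qed
    obtain y where y: "y \<in> C" "frechet_derivative u (at y) = (\<lambda>h. 0)"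
    proof (rule critical_point_of_zero_boundary_values[OF C(1) _ _ fr _ C(4)])
      show "bounded C" using \<Omega>(2) C\<Omega> bounded_subset by blast
      show "continuous_on (closure C) u" using continuous_on_subset[OF u(1) cC] .
      show "(u has_derivative frechet_derivative u (at x)) (at x)" if "x \<in> C" for x
        using Ck_extends_has_derivative[OF u2] that C\<Omega> by blast
      show "u x0 \<noteq> 0" using x0 by (simp add: W_def)
    qed blast
    then have "w i y = 0" by (simp add: w_def vf_def)
    then show False using const[OF y(1)] i by simp
  qed
  show ?thesis
  proof (rule ccontr)
    assume "u x \<noteq> 0"
    define U where "U = {x \<in> \<Omega>. u x \<noteq> 0}"
    have xU: "x \<in> U" using \<open>u x \<noteq> 0\<close> \<open>x \<in> \<Omega>\<close> by (simp add: U_def)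
    have oU: "open U" unfolding U_def by (rule open_ne[OF u2])
    have U\<Omega>: "U \<subseteq> \<Omega>" by (auto simp: U_def)
    define C where "C = connected_component_set U x"
    note C = open_component_properties[OF oU xU, folded C_def]
    have C\<Omega>: "C \<subseteq> \<Omega>" using C(3) U\<Omega> by blast
    have cC: "closure C \<subseteq> closure \<Omega>" using C\<Omega> by (rule closure_mono)
    have "(u has_derivative (\<lambda>h. 0)) (at z)" if "z \<in> U" for z
    proof (rule X_gradient_zero_imp_derivative_zero[OF X oU _ _ that])
      show "Ck_extends (Suc (Suc 0)) u U" using Ck_extends_subset[OF u2 U\<Omega>] .
      show "vf (X j) u x = 0" if "x \<in> U" for j x
        using \<open>W = {}\<close> that unfolding W_def U_def w_def by blast
    qed
    then have const: "u z = u x" if "z \<in> C" for z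
      using has_derivative_zero_unique_connected[OF C(1,2) _ that C(4)] C(3) by blast
    have "bounded C" using \<Omega>(2) C\<Omega> bounded_subset by blast
    then have "C \<noteq> UNIV" using not_bounded_UNIV by metis
    then have "frontier C \<noteq> {}" using C(4) by (auto simp: frontier_eq_empty)
    then obtain y where y: "y \<in> frontier C" by blast
    have yc: "y \<in> closure C" using y by (simp add: frontier_def)
    have "u y = u x"
      by (rule continuous_constant_on_closure[OF continuous_on_subset[OF u(1) cC] const yc])
    moreover have "u y = 0"
      using C(5)[OF y] closure_cases[of y] yc cC unfolding U_def by blast
    ultimately show False using \<open>u x \<noteq> 0\<close> by simp
  qed
qed

section \<open>The Pohozaev identity\<close>

lemma smooth_euler_field: "smooth (euler_field \<sigma>)"
  by (rule smooth_bounded_linear[OF euler_field_bounded_linear])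

lemma vf_minus:
  assumes "f differentiable (at x)"
  shows "vf Y (\<lambda>y. - f y) x = - vf Y f x"
  using vf_cmult[OF assms, of Y "-1"] by simp

text \<open>In operator form: \<open>Y T = T Y + Y\<close> for the Euler field \<open>T\<close> and \<open>Y\<close> homogeneous of degree \<open>1\<close>.\<close>

lemma vf_euler_commutator:
  assumes "homogeneous_field \<sigma> Y" "smooth Y" "open S" "Ck_extends (Suc (Suc 0)) u S" "x \<in> S"
  shows "vf Y (vf (euler_field \<sigma>) u) x = vf (euler_field \<sigma>) (vf Y u) x + vf Y u x"
proof -
  note Y = smooth_imp_differentiable[OF assms(2)]
  have "vf Y (vf (euler_field \<sigma>) u) x - vf (euler_field \<sigma>) (vf Y u) x
      = vf (lie_bracket Y (euler_field \<sigma>)) u x"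
    by (rule vf_commutator[OF assms(3,5,4) Y smooth_imp_differentiable[OF smooth_euler_field]])
  also have "\<dots> = vf Y u x"
    by (simp add: vf_def lie_bracket_euler_field[OF assms(1) Y])
  finally show ?thesis by simp
qed

text \<open>The contribution of a pair of fields \<open>Y = X_i\<close>, \<open>Z = X_j\<close> with weight \<open>G = F_r_ij\<close> to the
  Pohozaev field. Moving both derivatives in \<open>G (Z Y T u)\<close> onto \<open>G\<close> leaves, up to sign, the divergence
  of \<open>Z (G) (T u) Y - G (Y T u) Z\<close>. The flux defined here is that field plus
  \<open>T (h) Z - Z (h) T + (q - 1) h Z\<close>, where \<open>h = G (Y u)\<close>; the added field is divergence-free when \<open>Z\<close> is
  homogeneous of degree \<open>1\<close>. With this correction every coefficient other
  than that of \<open>T\<close> vanishes wherever \<open>u\<close> and its gradient do.\<close>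

definition second_order_flux ::
    "('n \<Rightarrow> nat) \<Rightarrow> (real^'n \<Rightarrow> real^'n) \<Rightarrow> (real^'n \<Rightarrow> real^'n) \<Rightarrow> (real^'n \<Rightarrow> real) \<Rightarrow>
     (real^'n \<Rightarrow> real) \<Rightarrow> real^'n::finite \<Rightarrow> real^'n" where
  "second_order_flux \<sigma> Y Z u G x =
     (- vf Z (\<lambda>y. vf Y u y * G y) x) *\<^sub>R euler_field \<sigma> x
     + (vf Z G x * vf (euler_field \<sigma>) u x) *\<^sub>R Y x
     + (vf Y u x * (vf (euler_field \<sigma>) G x + (real (hom_dim \<sigma>) - 2) * G x)) *\<^sub>R Z x"

lemma Ck_extends_second_order_flux:
  assumes "smooth Y" "smooth Z" "open S"
    and u: "Ck_extends (Suc (Suc (Suc 0))) u S" and G: "Ck_extends (Suc (Suc 0)) G S"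
  shows "Ck_extends (Suc 0) (second_order_flux \<sigma> Y Z u G) S"
proof -
  note s = smooth_imp_Ck_extends[OF assms(1)] smooth_imp_Ck_extends[OF assms(2)]
    smooth_imp_Ck_extends[OF smooth_euler_field]
  note u2 = Ck_extends_Suc_imp[OF u] and G1 = Ck_extends_Suc_imp[OF G]
  have w: "Ck_extends (Suc (Suc 0)) (vf Y u) S" by (rule Ck_extends_vf[OF assms(3) s(1) u])
  have "Ck_extends (Suc 0) (vf Z (\<lambda>y. vf Y u y * G y)) S"
    by (intro Ck_extends_vf Ck_extends_mult assms(3) s w G)
  then have "Ck_extends (Suc 0) (\<lambda>x. - vf Z (\<lambda>y. vf Y u y * G y) x) S"
    by (rule Ck_extends_bounded_linear[OF assms(3) bounded_linear_minus[OF bounded_linear_ident]])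
  then show ?thesis
    unfolding second_order_flux_def
    by (intro Ck_extends_add Ck_extends_scaleR Ck_extends_mult Ck_extends_const assms(3) s
        Ck_extends_vf[OF assms(3) _ G] Ck_extends_vf[OF assms(3) _ u2] G1)
qed

lemma divergence_second_order_flux:
  assumes hom: "homogeneous_field \<sigma> Y" "homogeneous_field \<sigma> Z" and smooth: "smooth Y" "smooth Z"
    and S: "open S" "x \<in> S"
    and u: "Ck_extends (Suc (Suc (Suc 0))) u S" and G: "Ck_extends (Suc (Suc 0)) G S"
  shows "divergence (second_order_flux \<sigma> Y Z u G) x =
      vf Y (vf Z G) x * vf (euler_field \<sigma>) u x
      - G x * vf (euler_field \<sigma>) (vf Z (vf Y u)) x - 2 * G x * vf Z (vf Y u) x"
proof -
  define T where "T = euler_field \<sigma>"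
  define q where "q = real (hom_dim \<sigma>)"
  define w where "w = vf Y u"
  note s = smooth_imp_Ck_extends[OF smooth(1)] smooth_imp_Ck_extends[OF smooth(2)]
    smooth_imp_Ck_extends[OF smooth_euler_field[of \<sigma>], folded T_def]
  note u2 = Ck_extends_Suc_imp[OF u]
  have w2: "Ck_extends (Suc (Suc 0)) w S" unfolding w_def by (rule Ck_extends_vf[OF S(1) s(1) u])
  have wG: "Ck_extends (Suc (Suc 0)) (\<lambda>y. w y * G y) S" by (rule Ck_extends_mult[OF S(1) w2 G])
  note d = Ck_extends_differentiable[OF _ S(2)]
  have dG: "G differentiable (at y)" and dw: "w differentiable (at y)" if "y \<in> S" for y
    using Ck_extends_differentiable[OF G that] Ck_extends_differentiable[OF w2 that] .
  have dZG: "vf Z G differentiable (at x)" and dTG: "vf T G differentiable (at x)"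
    and dTw: "vf T w differentiable (at x)" and dTu: "vf T u differentiable (at x)"
    and dZwG: "vf Z (\<lambda>y. w y * G y) differentiable (at x)"
    by (rule d[OF Ck_extends_vf[OF S(1) s(2) G]] d[OF Ck_extends_vf[OF S(1) s(3) G]]
        d[OF Ck_extends_vf[OF S(1) s(3) w2]] d[OF Ck_extends_vf[OF S(1) s(3) u2]]
        d[OF Ck_extends_vf[OF S(1) s(2) wG]])+
  note dx = dG[OF S(2)] dw[OF S(2)] dZG dTG dTw dTu dZwG
  have dY: "Y differentiable (at x)" and dZ: "Z differentiable (at x)" and dT: "T differentiable (at x)"
    using smooth_imp_differentiable smooth smooth_euler_field unfolding T_def by blast+
  have div: "divergence Y x = 0" "divergence Z x = 0" "divergence T x = q"
    by (simp_all add: divergence_homogeneous_field[OF hom(1) smooth(1)]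
        divergence_homogeneous_field[OF hom(2) smooth(2)] divergence_euler_field T_def q_def)
  have "vf Z (vf T (\<lambda>y. w y * G y)) x = vf Z (\<lambda>y. w y * vf T G y + vf T w y * G y) x"
    by (rule vf_cong[OF S]) (simp add: vf_mult dw dG)
  also have "\<dots> = w x * vf Z (vf T G) x + vf Z w x * vf T G x + vf T w x * vf Z G x + vf Z (vf T w) x * G x"
    using dx by (simp add: vf_add vf_mult)
  finally have ZT: "vf Z (vf T (\<lambda>y. w y * G y)) x
      = w x * vf Z (vf T G) x + vf Z w x * vf T G x + vf T w x * vf Z G x + vf Z (vf T w) x * G x" .
  have com: "vf T (vf Z (\<lambda>y. w y * G y)) x = vf Z (vf T (\<lambda>y. w y * G y)) x - vf Z (\<lambda>y. w y * G y) x"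
    "vf Z (vf T w) x = vf T (vf Z w) x + vf Z w x"
    "vf Y (vf T u) x = vf T w x + w x"
    using vf_euler_commutator[OF hom(2) smooth(2) S(1) wG S(2)]
      vf_euler_commutator[OF hom(2) smooth(2) S(1) w2 S(2)]
      vf_euler_commutator[OF hom(1) smooth(1) S(1) u2 S(2)]
    by (simp_all add: T_def w_def)
  have wGx: "vf Z (\<lambda>y. w y * G y) x = w x * vf Z G x + vf Z w x * G x"
    using dx by (simp add: vf_mult)
  have d1: "divergence (\<lambda>y. (- vf Z (\<lambda>y. w y * G y) y) *\<^sub>R T y) x
      = - vf T (vf Z (\<lambda>y. w y * G y)) x - q * vf Z (\<lambda>y. w y * G y) x"
    using dx dT by (subst divergence_scaleR) (simp_all add: vf_minus div)
  have d2: "divergence (\<lambda>y. (vf Z G y * vf T u y) *\<^sub>R Y y) x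
      = vf Z G x * vf Y (vf T u) x + vf Y (vf Z G) x * vf T u x"
    using dx dY by (simp add: divergence_scaleR vf_mult div)
  have d3: "divergence (\<lambda>y. (w y * (vf T G y + (q - 2) * G y)) *\<^sub>R Z y) x
      = w x * (vf Z (vf T G) x + (q - 2) * vf Z G x) + vf Z w x * (vf T G x + (q - 2) * G x)"
    using dx dZ by (simp add: divergence_scaleR vf_mult vf_add vf_const div)
  have "divergence (second_order_flux \<sigma> Y Z u G) x
      = divergence (\<lambda>y. (- vf Z (\<lambda>y. w y * G y) y) *\<^sub>R T y) x
       + divergence (\<lambda>y. (vf Z G y * vf T u y) *\<^sub>R Y y) x
       + divergence (\<lambda>y. (w y * (vf T G y + (q - 2) * G y)) *\<^sub>R Z y) x"
    unfolding second_order_flux_def[abs_def] T_def[symmetric] q_def[symmetric] w_def[symmetric]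
    using dx dY dZ dT
    by (subst divergence_add, (intro derivative_intros; simp), (intro derivative_intros; simp))+ (rule refl)
  then show ?thesis
    unfolding d1 d2 d3 com(1) ZT wGx com(2,3) T_def[symmetric] w_def[symmetric]
    by (simp add: algebra_simps)
qed

text \<open>The field whose divergence is the Pohozaev density, for \<open>\<phi>\<close>, \<open>P i\<close>, \<open>G i j\<close> equal to \<open>F\<close>,
  \<open>F_p_i\<close>, \<open>F_r_ij\<close> along the jet of \<open>u\<close>. These functions are kept abstract: the divergence identity
  only needs the chain rule for \<open>\<phi>\<close> and the equation.\<close>

definition pohozaev_field ::
    "('n \<Rightarrow> nat) \<Rightarrow> ('m::finite \<Rightarrow> real^'n \<Rightarrow> real^'n) \<Rightarrow> (real^'n \<Rightarrow> real) \<Rightarrow> (real^'n \<Rightarrow> real) \<Rightarrow>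
     ('m \<Rightarrow> real^'n \<Rightarrow> real) \<Rightarrow> ('m \<Rightarrow> 'm \<Rightarrow> real^'n \<Rightarrow> real) \<Rightarrow> real^'n::finite \<Rightarrow> real^'n" where
  "pohozaev_field \<sigma> X u \<phi> P G x =
     \<phi> x *\<^sub>R euler_field \<sigma> x
     + (\<Sum>i\<in>UNIV. (- (P i x * vf (euler_field \<sigma>) u x)) *\<^sub>R X i x)
     + (\<Sum>i\<in>UNIV. \<Sum>j\<in>UNIV. second_order_flux \<sigma> (X i) (X j) u (G i j) x)"

lemma Ck_extends_pohozaev_field:
  assumes "\<And>i. smooth (X i)" "open S"
    and u: "Ck_extends (Suc (Suc (Suc 0))) u S"
    and \<phi>: "Ck_extends (Suc 0) \<phi> S" and P: "\<And>i. Ck_extends (Suc 0) (P i) S"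
    and G: "\<And>i j. Ck_extends (Suc (Suc 0)) (G i j) S"
  shows "Ck_extends (Suc 0) (pohozaev_field \<sigma> X u \<phi> P G) S"
proof -
  note s = smooth_imp_Ck_extends[OF assms(1)]
    smooth_imp_Ck_extends[OF smooth_euler_field]
  have "Ck_extends (Suc 0) (\<lambda>x. - (P i x * vf (euler_field \<sigma>) u x)) S" for i
    by (intro Ck_extends_bounded_linear[OF assms(2) bounded_linear_minus[OF bounded_linear_ident]]
        Ck_extends_mult Ck_extends_vf[OF assms(2) _ Ck_extends_Suc_imp[OF u]] assms(2) P s)
  then show ?thesis
    unfolding pohozaev_field_def[abs_def]
    by (intro Ck_extends_add Ck_extends_sum Ck_extends_scaleR
        Ck_extends_second_order_flux[of "X _" "X _" S u "G _ _", unfolded eta_contract_eq] assms(1,2) s u \<phi> P G)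
qed

text \<open>Here \<open>z\<close> stands for \<open>\<partial>_z F\<close> and \<open>A\<close> for the derivative of \<open>F\<close> along the Euler field in the
  variable \<open>x\<close> alone, both along the jet of \<open>u\<close>.\<close>

lemma divergence_pohozaev_field:
  fixes X :: "'m::finite \<Rightarrow> real^'n::finite \<Rightarrow> real^'n"
  assumes hom: "\<And>i. homogeneous_field \<sigma> (X i)" and smooth: "\<And>i. smooth (X i)"
    and S: "open S" "x \<in> S"
    and u: "Ck_extends (Suc (Suc (Suc 0))) u S"
    and \<phi>: "Ck_extends (Suc 0) \<phi> S" and P: "\<And>i. Ck_extends (Suc 0) (P i) S"
    and G: "\<And>i j. Ck_extends (Suc (Suc 0)) (G i j) S"
    and chain: "vf (euler_field \<sigma>) \<phi> x = A + z * vf (euler_field \<sigma>) u x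
        + (\<Sum>i\<in>UNIV. P i x * vf (euler_field \<sigma>) (vf (X i) u) x)
        + (\<Sum>i\<in>UNIV. \<Sum>j\<in>UNIV. G i j x * vf (euler_field \<sigma>) (vf (X j) (vf (X i) u)) x)"
    and eq: "(\<Sum>i\<in>UNIV. \<Sum>j\<in>UNIV. vf (X i) (vf (X j) (G i j)) x) - (\<Sum>i\<in>UNIV. vf (X i) (P i) x) + z = 0"
  shows "divergence (pohozaev_field \<sigma> X u \<phi> P G) x = real (hom_dim \<sigma>) * \<phi> x + A
      - (\<Sum>i\<in>UNIV. P i x * vf (X i) u x)
      - 2 * (\<Sum>i\<in>UNIV. \<Sum>j\<in>UNIV. G i j x * vf (X j) (vf (X i) u) x)"
proof -
  define T where "T = euler_field \<sigma>"
  define q where "q = real (hom_dim \<sigma>)"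
  define v where "v = vf T u x"
  note u2 = Ck_extends_Suc_imp[OF u]
  have dT: "T differentiable (at x)" and dX: "X i differentiable (at x)" for i
    using smooth_imp_differentiable smooth smooth_euler_field unfolding T_def by blast+
  have d\<phi>: "\<phi> differentiable (at x)" and dP: "P i differentiable (at x)" for i
    by (rule Ck_extends_differentiable[OF _ S(2)], rule \<phi> P)+
  have dv: "vf T u differentiable (at x)"
    unfolding T_def
    by (rule Ck_extends_differentiable[OF Ck_extends_vf[OF S(1) _ u2] S(2)])
       (rule smooth_imp_Ck_extends[OF smooth_euler_field])
  have dP': "(\<lambda>y. (- (P i y * vf T u y)) *\<^sub>R X i y) differentiable (at x)" for i
    by (intro differentiable_scaleR differentiable_minus differentiable_mult dP dv dX)
  have dF: "second_order_flux \<sigma> (X i) (X j) u (G i j) differentiable (at x)" for i j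
    by (rule Ck_extends_differentiable[OF Ck_extends_second_order_flux[OF smooth smooth S(1) u G] S(2)])
  have 1: "divergence (\<lambda>y. \<phi> y *\<^sub>R T y) x = vf T \<phi> x + q * \<phi> x"
    using divergence_scaleR[OF d\<phi> dT] by (simp add: T_def q_def divergence_euler_field)
  have 2: "divergence (\<lambda>y. (- (P i y * vf T u y)) *\<^sub>R X i y) x
      = - (P i x * (vf T (vf (X i) u) x + vf (X i) u x)) - vf (X i) (P i) x * v" for i
  proof -
    have "divergence (\<lambda>y. (- (P i y * vf T u y)) *\<^sub>R X i y) x = vf (X i) (\<lambda>y. - (P i y * vf T u y)) x"
      using dP dv dX
      by (subst divergence_scaleR)
         (simp_all add: divergence_homogeneous_field[OF hom smooth])
    also have "\<dots> = - (P i x * vf (X i) (vf T u) x + vf (X i) (P i) x * v)"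
      using dP dv by (simp add: vf_minus vf_mult v_def)
    also have "vf (X i) (vf T u) x = vf T (vf (X i) u) x + vf (X i) u x"
      unfolding T_def by (rule vf_euler_commutator[OF hom smooth S(1) u2 S(2)])
    finally show ?thesis by simp
  qed
  have 3: "divergence (second_order_flux \<sigma> (X i) (X j) u (G i j)) x
      = vf (X i) (vf (X j) (G i j)) x * v
      - G i j x * vf T (vf (X j) (vf (X i) u)) x - 2 * (G i j x * vf (X j) (vf (X i) u) x)" for i j
    using divergence_second_order_flux[OF hom hom smooth smooth S u G] by (simp add: T_def v_def)
  have "divergence (pohozaev_field \<sigma> X u \<phi> P G) x
      = divergence (\<lambda>y. \<phi> y *\<^sub>R T y) x
       + (\<Sum>i\<in>UNIV. divergence (\<lambda>y. (- (P i y * vf T u y)) *\<^sub>R X i y) x)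
       + (\<Sum>i\<in>UNIV. \<Sum>j\<in>UNIV. divergence (second_order_flux \<sigma> (X i) (X j) u (G i j)) x)"
    using d\<phi> dT dP' dF
    unfolding pohozaev_field_def[abs_def] T_def[symmetric]
    by (subst divergence_add divergence_sum; (intro differentiable_add differentiable_sum differentiable_scaleR)?; simp)+
  also have "\<dots> = vf T \<phi> x + q * \<phi> x
       - (\<Sum>i\<in>UNIV. P i x * vf T (vf (X i) u) x) - (\<Sum>i\<in>UNIV. P i x * vf (X i) u x)
       - (\<Sum>i\<in>UNIV. vf (X i) (P i) x) * v
       + (\<Sum>i\<in>UNIV. \<Sum>j\<in>UNIV. vf (X i) (vf (X j) (G i j)) x) * v
       - (\<Sum>i\<in>UNIV. \<Sum>j\<in>UNIV. G i j x * vf T (vf (X j) (vf (X i) u)) x)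
       - 2 * (\<Sum>i\<in>UNIV. \<Sum>j\<in>UNIV. G i j x * vf (X j) (vf (X i) u) x)"
    unfolding 1 2 3
    by (simp add: sum_subtractf sum_negf sum.distrib sum_distrib_left sum_distrib_right algebra_simps)
  also have "\<dots> = q * \<phi> x + A
      - (\<Sum>i\<in>UNIV. P i x * vf (X i) u x)
      - 2 * (\<Sum>i\<in>UNIV. \<Sum>j\<in>UNIV. G i j x * vf (X j) (vf (X i) u) x)
      + ((\<Sum>i\<in>UNIV. \<Sum>j\<in>UNIV. vf (X i) (vf (X j) (G i j)) x) - (\<Sum>i\<in>UNIV. vf (X i) (P i) x) + z) * v"
    using chain by (simp add: T_def v_def algebra_simps)
  finally show ?thesis using eq by (simp add: q_def)
qed

text \<open>At a boundary point where \<open>u\<close> and its gradient vanish, only the Euler direction survives.\<close>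

lemma tendsto_second_order_flux:
  assumes smooth: "smooth Y" "smooth Z" and S: "open S" "x \<in> closure S"
    and u: "Ck_extends (Suc (Suc (Suc 0))) u S" and G: "Ck_extends (Suc (Suc 0)) G S"
    and lim: "(vf Y u \<longlongrightarrow> 0) (at x within S)" "(vf (euler_field \<sigma>) u \<longlongrightarrow> 0) (at x within S)"
      "(vf Z (vf Y u) \<longlongrightarrow> h) (at x within S)" "(G \<longlongrightarrow> g) (at x within S)"
  shows "(second_order_flux \<sigma> Y Z u G \<longlongrightarrow> (- (h * g)) *\<^sub>R euler_field \<sigma> x) (at x within S)"
proof -
  have w: "Ck_extends (Suc (Suc 0)) (vf Y u) S"
    by (rule Ck_extends_vf[OF S(1) smooth_imp_Ck_extends[OF smooth(1)] u])
  have "continuously_extends (vf U G) S" if "smooth U" for U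
    by (rule Ck_extends_imp_continuously_extends[OF Ck_extends_vf[OF S(1) smooth_imp_Ck_extends[OF that] G]])
  then obtain a b where a: "(vf Z G \<longlongrightarrow> a) (at x within S)"
    and b: "(vf (euler_field \<sigma>) G \<longlongrightarrow> b) (at x within S)"
    using continuously_extends_limit S(2) smooth(2) smooth_euler_field by metis
  have "((\<lambda>y. vf Y u y * vf Z G y + vf Z (vf Y u) y * G y) \<longlongrightarrow> 0 * a + h * g) (at x within S)"
    by (intro tendsto_intros lim a)
  moreover have "eventually (\<lambda>y. vf Y u y * vf Z G y + vf Z (vf Y u) y * G y
      = vf Z (\<lambda>y. vf Y u y * G y) y) (at x within S)"
    using vf_mult[OF Ck_extends_differentiable[OF w] Ck_extends_differentiable[OF G]]
    by (auto simp: eventually_at_topological)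
  ultimately have 1: "(vf Z (\<lambda>y. vf Y u y * G y) \<longlongrightarrow> 0 * a + h * g) (at x within S)"
    by (rule Lim_transform_eventually)
  have "(second_order_flux \<sigma> Y Z u G \<longlongrightarrow> (- (0 * a + h * g)) *\<^sub>R euler_field \<sigma> x
      + (a * 0) *\<^sub>R Y x + (0 * (b + (real (hom_dim \<sigma>) - 2) * g)) *\<^sub>R Z x) (at x within S)"
    unfolding second_order_flux_def[abs_def]
    by (intro tendsto_intros 1 a b lim smooth_tendsto smooth smooth_euler_field)
  then show ?thesis by simp
qed

lemma tendsto_pohozaev_field:
  fixes X :: "'m::finite \<Rightarrow> real^'n::finite \<Rightarrow> real^'n"
  assumes smooth: "\<And>i. smooth (X i)" and S: "open S" "x \<in> closure S"
    and u: "Ck_extends (Suc (Suc (Suc 0))) u S"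
    and P: "\<And>i. Ck_extends (Suc 0) (P i) S"
    and G: "\<And>i j. Ck_extends (Suc (Suc 0)) (G i j) S"
    and lim: "\<And>i. (vf (X i) u \<longlongrightarrow> 0) (at x within S)" "(vf (euler_field \<sigma>) u \<longlongrightarrow> 0) (at x within S)"
      "\<And>i j. (vf (X j) (vf (X i) u) \<longlongrightarrow> h i j) (at x within S)"
      "\<And>i j. (G i j \<longlongrightarrow> g i j) (at x within S)" "(\<phi> \<longlongrightarrow> f) (at x within S)"
  shows "(pohozaev_field \<sigma> X u \<phi> P G \<longlongrightarrow>
      (f - (\<Sum>i\<in>UNIV. \<Sum>j\<in>UNIV. h i j * g i j)) *\<^sub>R euler_field \<sigma> x) (at x within S)"
proof -
  have "\<exists>a. (P i \<longlongrightarrow> a) (at x within S)" for i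
    using continuously_extends_limit[OF Ck_extends_imp_continuously_extends[OF P] S(2)] by metis
  then obtain a where a: "\<And>i. (P i \<longlongrightarrow> a i) (at x within S)" by metis
  have "(pohozaev_field \<sigma> X u \<phi> P G \<longlongrightarrow> f *\<^sub>R euler_field \<sigma> x
      + (\<Sum>i\<in>UNIV. (- (a i * 0)) *\<^sub>R X i x)
      + (\<Sum>i\<in>UNIV. \<Sum>j\<in>UNIV. (- (h i j * g i j)) *\<^sub>R euler_field \<sigma> x)) (at x within S)"
    unfolding pohozaev_field_def[abs_def]
    by (intro tendsto_intros tendsto_second_order_flux a lim smooth_tendsto smooth smooth_euler_field S u G)
  then show ?thesis by (simp add: scaleR_diff_left sum_negf scaleR_sum_left)
qed

section \<open>The Lagrangian along a jet\<close>

lemma jet_expansion: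
  fixes x :: "real^'n::finite" and p :: "real^'m::finite" and r :: "real^'m^'m"
  shows "(x, z, p, r) = (x, 0, 0, 0) + z *\<^sub>R (0, 1, 0, 0)
    + (\<Sum>i\<in>UNIV. p $ i *\<^sub>R (0, 0, axis i 1, 0))
    + (\<Sum>i\<in>UNIV. \<Sum>j\<in>UNIV. r $ i $ j *\<^sub>R (0, 0, 0, axis i (axis j 1)))"
proof -
  have 1: "(\<Sum>i\<in>UNIV. p $ i *\<^sub>R axis i 1) = p"
    using basis_expansion[of p] by (simp add: scalar_mult_eq_scaleR)
  have 2: "(\<Sum>i\<in>UNIV. \<Sum>j\<in>UNIV. r $ i $ j *\<^sub>R axis i (axis j (1::real))) = r"
  proof -
    have "(\<Sum>j\<in>UNIV. r $ i $ j *\<^sub>R axis i (axis j (1::real))) = axis i (r $ i)" for i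
      by (auto simp: vec_eq_iff axis_def if_distrib cong: if_cong)
    moreover have "(\<Sum>i\<in>UNIV. axis i (r $ i)) = r"
      by (simp add: vec_eq_iff axis_def)
    ultimately show ?thesis by simp
  qed
  have P: "(\<Sum>i\<in>UNIV. p $ i *\<^sub>R (0, 0, axis i 1, 0)) = (0::real^'n, 0::real, p, 0::real^'m^'m)"
    by (subst 1[symmetric]) (simp add: prod_eq_iff fst_sum snd_sum)
  have R: "(\<Sum>i\<in>UNIV. \<Sum>j\<in>UNIV. r $ i $ j *\<^sub>R (0, 0, 0, axis i (axis j 1)))
      = (0::real^'n, 0::real, 0::real^'m, r)"
    by (subst 2[symmetric]) (simp add: prod_eq_iff fst_sum snd_sum)
  show ?thesis unfolding P R by simp
qed

lemma jet_of_expansion: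
  fixes X :: "'m::finite \<Rightarrow> real^'n::finite \<Rightarrow> real^'n"
  shows "jet_of X u x = (x, 0, 0, 0) + u x *\<^sub>R (0, 1, 0, 0)
    + (\<Sum>i\<in>UNIV. vf (X i) u x *\<^sub>R (0, 0, axis i 1, 0))
    + (\<Sum>i\<in>UNIV. \<Sum>j\<in>UNIV. vf (X j) (vf (X i) u) x *\<^sub>R (0, 0, 0, axis i (axis j 1)))"
  unfolding jet_of_def by (subst jet_expansion) (simp add: X_grad_def X_hess_def)

lemma bounded_linear_base: "bounded_linear (\<lambda>x. (x, 0, 0, 0))"
  by (intro bounded_linear_Pair bounded_linear_ident bounded_linear_zero)

lemma Ck_extends_jet_of:
  fixes X :: "'m::finite \<Rightarrow> real^'n::finite \<Rightarrow> real^'n"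
  assumes "\<And>i. smooth (X i)" "open S" "Ck_extends (Suc (Suc (Suc (Suc 0)))) u S"
  shows "Ck_extends (Suc (Suc 0)) (jet_of X u) S"
proof -
  note s = smooth_imp_Ck_extends[OF assms(1)]
  have w: "Ck_extends (Suc (Suc (Suc 0))) (vf (X i) u) S" for i
    by (rule Ck_extends_vf[OF assms(2) s assms(3)])
  have h: "Ck_extends (Suc (Suc 0)) (vf (X j) (vf (X i) u)) S" for i j
    by (rule Ck_extends_vf[OF assms(2) s w])
  have "Ck_extends (Suc (Suc 0)) (\<lambda>x. (x, 0, 0, 0) + u x *\<^sub>R (0, 1, 0, 0)
    + (\<Sum>i\<in>UNIV. vf (X i) u x *\<^sub>R (0, 0, axis i 1, 0))
    + (\<Sum>i\<in>UNIV. \<Sum>j\<in>UNIV. vf (X j) (vf (X i) u) x *\<^sub>R (0, 0, 0, axis i (axis j 1)))) S"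
    by (intro Ck_extends_add Ck_extends_sum Ck_extends_scaleR Ck_extends_const
        Ck_extends_linear[OF _ bounded_linear_base] h Ck_extends_Suc_imp[OF w]
        Ck_extends_Suc_imp[OF Ck_extends_Suc_imp[OF assms(3)]] assms(2))
  then show ?thesis
    by (rule Ck_extends_cong[OF assms(2), rotated]) (simp only: jet_of_expansion)
qed

lemma jet_of_image: "jet_of X u ` S \<subseteq> jet_domain S"
  by (auto simp: jet_of_def jet_domain_def)

text \<open>The chain rule for the derivative of \<open>F\<close> along the jet of \<open>u\<close> in the direction of a field \<open>Y\<close>.\<close>

lemma vf_along_jet:
  fixes X :: "'m::finite \<Rightarrow> real^'n::finite \<Rightarrow> real^'n"
  assumes "\<And>i. smooth (X i)" "open S" "Ck_extends (Suc (Suc (Suc (Suc 0)))) u S" "x \<in> S"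
    "F differentiable (at (jet_of X u x))"
  shows "vf Y (\<lambda>y. F (jet_of X u y)) x
     = (\<Sum>k\<in>UNIV. Y x $ k * d_x F k (jet_of X u x)) + d_z F (jet_of X u x) * vf Y u x
       + (\<Sum>i\<in>UNIV. d_p F i (jet_of X u x) * vf Y (vf (X i) u) x)
       + (\<Sum>i\<in>UNIV. \<Sum>j\<in>UNIV. d_r F i j (jet_of X u x) * vf Y (vf (X j) (vf (X i) u)) x)"
proof -
  let ?DF = "frechet_derivative F (at (jet_of X u x))"
  note s = smooth_imp_Ck_extends[OF assms(1)]
  have w: "Ck_extends (Suc (Suc (Suc 0))) (vf (X i) u) S" for i
    by (rule Ck_extends_vf[OF assms(2) s assms(3)])
  have h: "Ck_extends (Suc (Suc 0)) (vf (X j) (vf (X i) u)) S" for i j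
    by (rule Ck_extends_vf[OF assms(2) s w])
  have F: "(F has_derivative ?DF) (at (jet_of X u x))"
    using assms(5) by (simp flip: frechet_derivative_works)
  have L: "linear ?DF" using has_derivative_linear[OF F] .
  let ?J = "\<lambda>h. (h, 0, 0, 0) + frechet_derivative u (at x) h *\<^sub>R (0, 1, 0, 0)
    + (\<Sum>i\<in>UNIV. frechet_derivative (vf (X i) u) (at x) h *\<^sub>R (0, 0, axis i 1, 0))
    + (\<Sum>i\<in>UNIV. \<Sum>j\<in>UNIV. frechet_derivative (vf (X j) (vf (X i) u)) (at x) h *\<^sub>R
        (0, 0, 0, axis i (axis j 1)))"
  have "(jet_of X u has_derivative ?J) (at x)"
    unfolding jet_of_expansion[abs_def]
    by (intro has_derivative_add has_derivative_sum has_derivative_scaleR_left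
        bounded_linear_imp_has_derivative bounded_linear_base
        Ck_extends_has_derivative[OF assms(3,4)] Ck_extends_has_derivative[OF w assms(4)]
        Ck_extends_has_derivative[OF h assms(4)])
  from vf_at[OF has_derivative_compose[OF this F]]
  have "vf Y (\<lambda>y. F (jet_of X u y)) x = ?DF (?J (Y x))" .
  also have "\<dots> = ?DF (Y x, 0, 0, 0) + vf Y u x * d_z F (jet_of X u x)
      + (\<Sum>i\<in>UNIV. vf Y (vf (X i) u) x * d_p F i (jet_of X u x))
      + (\<Sum>i\<in>UNIV. \<Sum>j\<in>UNIV. vf Y (vf (X j) (vf (X i) u)) x * d_r F i j (jet_of X u x))"
    by (simp only: linear_add[OF L] linear_sum[OF L] linear_cmul[OF L] real_scaleR_def
        vf_def[of Y] d_z_def d_p_def d_r_def)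
  also have "?DF (Y x, 0, 0, 0) = (\<Sum>k\<in>UNIV. Y x $ k * d_x F k (jet_of X u x))"
    using linear_cart_expansion[OF linear_compose[OF bounded_linear.linear[OF bounded_linear_base] L], of "Y x"]
    by (simp add: o_def d_x_def)
  finally show ?thesis by (simp add: mult_ac)
qed


section \<open>The Pohozaev field of a solution\<close>

text \<open>A field with non-negative divergence and nowhere positive outward normal component has divergence
  zero, since the integral of its divergence is both non-negative and non-positive.\<close>

lemma divergence_zero_of_inward_flux:
  fixes \<Omega> :: "(real^'n::finite) set"
  assumes reg: "divergence_regular \<Omega>" and \<Omega>: "open \<Omega>" "bounded \<Omega>"
    and V: "Ck_closure 1 V \<Omega>" and div: "\<And>x. x \<in> \<Omega> \<Longrightarrow> 0 \<le> divergence V x"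
    and flux: "\<And>x. x \<in> frontier \<Omega> \<Longrightarrow> V x \<bullet> outward_normal \<Omega> x \<le> 0" and "x \<in> \<Omega>"
  shows "divergence V x = 0"
proof -
  let ?I = "\<lambda>x. indicator \<Omega> x *\<^sub>R divergence V x"
  have V1: "Ck_extends (Suc 0) V \<Omega>" using V by (simp add: Ck_closure_def)
  have ext: "continuously_extends (divergence V) \<Omega>"
  proof -
    have "Ck_extends 0 (\<lambda>x. \<Sum>k\<in>UNIV. frechet_derivative V (at x) (axis k 1) $ k) \<Omega>"
      by (intro Ck_extends_sum Ck_extends_vec_nth Ck_extends_partial V1 \<Omega>)
    then show ?thesis by (simp add: divergence_def[abs_def])
  qed
  then obtain g where g: "continuous_on (closure \<Omega>) g" "\<And>x. x \<in> \<Omega> \<Longrightarrow> g x = divergence V x"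
    unfolding continuously_extends_def by blast
  have "set_integrable lborel (closure \<Omega>) g"
    unfolding set_integrable_def using \<Omega>(2) g(1) by (intro borel_integrable_compact) auto
  then have "set_integrable lborel \<Omega> g"
    by (rule set_integrable_subset) (use \<Omega>(1) closure_subset in auto)
  moreover have "(\<lambda>x. indicator \<Omega> x *\<^sub>R g x) = ?I"
    using g(2) by (auto simp: indicator_def)
  ultimately have int: "integrable lborel ?I" by (simp add: set_integrable_def)
  have nonneg: "AE x in lborel. 0 \<le> ?I x" using div by (auto simp: indicator_def)
  have "(LINT x:\<Omega>|lborel. divergence V x)
      = (LINT x:frontier \<Omega>|hausdorff_measure (CARD('n) - 1). V x \<bullet> outward_normal \<Omega> x)"
    using reg V unfolding divergence_regular_def by blast
  \<comment> \<open>No integrability over the boundary is needed: the integral of a function that is not integrable is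
    \<open>0\<close> by convention.\<close>
  also have "\<dots> \<le> 0"
  proof -
    have "0 \<le> (LINT x:frontier \<Omega>|hausdorff_measure (CARD('n) - 1). - (V x \<bullet> outward_normal \<Omega> x))"
      unfolding set_lebesgue_integral_def using flux by (intro Bochner_Integration.integral_nonneg) (auto simp: indicator_def)
    then show ?thesis by (simp add: set_lebesgue_integral_def)
  qed
  finally have "integral\<^sup>L lborel ?I \<le> 0" by (simp add: set_lebesgue_integral_def)
  moreover have "0 \<le> integral\<^sup>L lborel ?I" using nonneg by (rule integral_nonneg_AE)
  ultimately have "AE x in lborel. ?I x = 0"
    using integral_nonneg_eq_0_iff_AE[OF int nonneg] by simp
  define N where "N = {x \<in> \<Omega>. divergence V x \<noteq> 0}"
  have "open N"
    using continuous_open_preimage[OF continuously_extends_imp_continuous_on[OF ext] \<Omega>(1), of "- {0}"]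
    by (simp add: N_def vimage_def Int_def open_Compl)
  have "AE x in lborel. x \<notin> N"
    using \<open>AE x in lborel. ?I x = 0\<close> by eventually_elim (auto simp: N_def indicator_def)
  then have "N \<in> null_sets lborel"
    using \<open>open N\<close> by (subst (asm) AE_iff_null_sets[symmetric]) auto
  then have "negligible N"
    by (simp add: negligible_iff_null_sets null_sets_completionI)
  then have "N = {}" using \<open>open N\<close> open_not_negligible by blast
  then show ?thesis using \<open>x \<in> \<Omega>\<close> by (auto simp: N_def)
qed

theorem theorem4p5:
  fixes X :: "'m::finite \<Rightarrow> real^'n::{finite,linorder} \<Rightarrow> real^'n::{finite,linorder}"
    and \<sigma> :: "'n \<Rightarrow> nat"
    and \<Omega> :: "(real^'n::{finite,linorder}) set"
    and F :: "('n, 'm) jet \<Rightarrow> real"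
  assumes smooth_X: "\<And>i. smooth (X i)"
    and indep_X: "linearly_independent_fields X"
    and exponents: "dilation_exponents \<sigma>"
    and H1: "\<And>i. homogeneous_field \<sigma> (X i)"
    and H2: "hormander_at_0 X"
    and domain: "open \<Omega>" "bounded \<Omega>" "connected \<Omega>"
    and regular: "divergence_regular \<Omega>"
    and star: "dil_star_shaped \<sigma> \<Omega>"
    and P: "lagrangian_regular \<Omega> F"
    and i: "\<And>x r. x \<in> frontier \<Omega> \<Longrightarrow>
        F (x, 0, 0, r) - (\<Sum>i\<in>UNIV. \<Sum>j\<in>UNIV. r $ i $ j * d_r F i j (x, 0, 0, r)) \<le> 0"
    and ii: "\<And>x z p r. x \<in> \<Omega> \<Longrightarrow> pohozaev_density \<sigma> F x z p r \<ge> 0"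
    and iii: "\<And>x z p r. x \<in> \<Omega> \<Longrightarrow> pohozaev_density \<sigma> F x z p r = 0 \<Longrightarrow> z = 0 \<or> p = 0 \<or> r = 0"
  shows "\<forall>u. Ck_closure 4 u \<Omega> \<and> solves_bvp X F \<Omega> u \<longrightarrow> (\<forall>x\<in>\<Omega>. u x = 0)"
proof (intro allI impI ballI, elim conjE)
  fix u x0
  assume u: "Ck_closure 4 u \<Omega>" and bvp: "solves_bvp X F \<Omega> u" and x0: "x0 \<in> \<Omega>"
  let ?J = "jet_of X u"
  define \<phi> where "\<phi> = (\<lambda>y. F (?J y))"
  define p where "p = (\<lambda>i y. d_p F i (?J y))"
  define G where "G = (\<lambda>i j y. d_r F i j (?J y))"
  define V where "V = pohozaev_field \<sigma> X u \<phi> p G"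
  define \<rho> where "\<rho> x = pohozaev_density \<sigma> F x (u x) (X_grad X u x) (X_hess X u x)" for x
  have J: "?J x = (x, u x, X_grad X u x, X_hess X u x)" for x by (simp add: jet_of_def)
  have u4: "Ck_extends (Suc (Suc (Suc (Suc 0)))) u \<Omega>"
    using u by (simp add: Ck_closure_def numeral_eq_Suc)
  note u3 = Ck_extends_Suc_imp[OF u4]
  note J2 = Ck_extends_jet_of[OF smooth_X domain(1) u4]
  note J1 = Ck_extends_Suc_imp[OF J2]
  obtain N where N: "open N" "closure (jet_domain \<Omega>) \<subseteq> N" "Ck_on 1 F N"
    using P unfolding lagrangian_regular_def by blast
  have F1: "Ck_extends (Suc 0) F (jet_domain \<Omega>)"
    using Ck_on_imp_Ck_extends[OF N(3,2)] by simp
  have Dp: "Ck_extends (Suc 0) (d_p F i) (jet_domain \<Omega>)" for i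
    using P unfolding lagrangian_regular_def Ck_closure_def by (simp del: Ck_extends.simps)
  have Dr: "Ck_extends (Suc (Suc 0)) (d_r F i j) (jet_domain \<Omega>)"
    and Dr_cont: "continuous_on (closure (jet_domain \<Omega>)) (d_r F i j)" for i j
    using P unfolding lagrangian_regular_def Ck_closure_def by (simp_all add: numeral_2_eq_2 del: Ck_extends.simps)
  have \<phi>1: "Ck_extends (Suc 0) \<phi> \<Omega>"
    unfolding \<phi>_def by (rule Ck_extends_compose[OF domain(1) jet_of_image J1 F1])
  have p1: "Ck_extends (Suc 0) (p i) \<Omega>" for i
    unfolding p_def by (rule Ck_extends_compose[OF domain(1) jet_of_image J1 Dp])
  have G2: "Ck_extends (Suc (Suc 0)) (G i j) \<Omega>" for i j
    unfolding G_def by (rule Ck_extends_compose[OF domain(1) jet_of_image J2 Dr])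
  have V1: "Ck_extends (Suc 0) V \<Omega>"
    unfolding V_def by (rule Ck_extends_pohozaev_field[OF smooth_X domain(1) u3 \<phi>1 p1 G2])

  have div_V: "divergence V x = \<rho> x" if x: "x \<in> \<Omega>" for x
  proof -
    let ?A = "\<Sum>k\<in>UNIV. real (\<sigma> k) * x $ k * d_x F k (?J x)"
    have "F differentiable (at (?J x))"
      by (rule Ck_extends_differentiable[OF F1]) (use x in \<open>auto simp: J jet_domain_def\<close>)
    from vf_along_jet[OF smooth_X domain(1) u4 x this, of "euler_field \<sigma>"]
    have chain: "vf (euler_field \<sigma>) \<phi> x = ?A + d_z F (?J x) * vf (euler_field \<sigma>) u x
        + (\<Sum>i\<in>UNIV. p i x * vf (euler_field \<sigma>) (vf (X i) u) x)
        + (\<Sum>i\<in>UNIV. \<Sum>j\<in>UNIV. G i j x * vf (euler_field \<sigma>) (vf (X j) (vf (X i) u)) x)"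
      unfolding \<phi>_def p_def G_def by (simp add: euler_field_def)
    have eq: "(\<Sum>i\<in>UNIV. \<Sum>j\<in>UNIV. vf (X i) (vf (X j) (G i j)) x)
        - (\<Sum>i\<in>UNIV. vf (X i) (p i) x) + d_z F (?J x) = 0"
      using bvp x unfolding solves_bvp_def X_div_def p_def G_def by simp
    show ?thesis
      unfolding V_def \<rho>_def pohozaev_density_def
      by (subst divergence_pohozaev_field[OF H1 smooth_X domain(1) x u3 \<phi>1 p1 G2 chain eq])
         (simp add: J \<phi>_def p_def G_def inner_vec_def X_grad_def X_hess_def mult.commute)
  qed

  \<comment> \<open>The derivatives in the formula for \<open>V\<close> are meaningful in \<open>\<Omega>\<close> only; on the frontier \<open>V\<close> is replaced
    by its limit from inside.\<close>
  have "continuously_extends V \<Omega>" using Ck_extends_imp_continuously_extends[OF V1] .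
  then obtain W where W: "continuous_on (closure \<Omega>) W" "\<And>x. x \<in> \<Omega> \<Longrightarrow> W x = V x"
    unfolding continuously_extends_def by blast
  have W1: "Ck_closure 1 W \<Omega>"
    using Ck_extends_cong[OF domain(1) W(2)[symmetric] V1] W(1) by (simp add: Ck_closure_def)
  have div_W: "divergence W x = \<rho> x" if "x \<in> \<Omega>" for x
    using divergence_cong[OF domain(1) that W(2)] div_V[OF that] by simp

  have boundary: "W x \<bullet> outward_normal \<Omega> x \<le> 0" if x: "x \<in> frontier \<Omega>" for x
  proof -
    let ?L = "at x within \<Omega>"
    have xc: "x \<in> closure \<Omega>" and xn: "x \<notin> \<Omega>"
      using x domain(1) by (auto simp: frontier_def interior_open)
    have nontriv: "?L \<noteq> bot"
      using xc xn by (simp add: trivial_limit_within closure_def)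
    have grad0: "(vf Y u \<longlongrightarrow> 0) ?L" if "smooth Y" for Y :: "real^'n::{finite,linorder} \<Rightarrow> _"
    proof -
      have "(grad u \<longlongrightarrow> 0) ?L" using bvp x unfolding solves_bvp_def by blast
      from tendsto_inner[OF smooth_tendsto[OF that] this] have "((\<lambda>y. Y y \<bullet> grad u y) \<longlongrightarrow> 0) ?L" by simp
      moreover have "Y y \<bullet> grad u y = vf Y u y" if "y \<in> \<Omega>" for y
        using vf_partials[OF Ck_extends_differentiable[OF u4 that]] by (simp add: inner_vec_def grad_def)
      then have "eventually (\<lambda>y. Y y \<bullet> grad u y = vf Y u y) ?L"
        by (auto simp: eventually_at_topological)
      ultimately show ?thesis by (rule Lim_transform_eventually)
    qed
    have ex_h: "\<exists>l. (vf (X j) (vf (X i) u) \<longlongrightarrow> l) ?L" for i j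
      by (rule continuously_extends_limit[OF Ck_extends_imp_continuously_extends[OF Ck_extends_vf[OF domain(1)
          smooth_imp_Ck_extends[OF smooth_X] Ck_extends_vf[OF domain(1) smooth_imp_Ck_extends[OF smooth_X] u3]]] xc])
         (rule exI)
    define h where "h i j = (SOME l. (vf (X j) (vf (X i) u) \<longlongrightarrow> l) ?L)" for i j
    have h: "(vf (X j) (vf (X i) u) \<longlongrightarrow> h i j) ?L" for i j
      unfolding h_def by (rule someI_ex[OF ex_h])
    \<comment> \<open>The boundary value of the \<open>X\<close>-Hessian, at which the boundary inequality is applied.\<close>
    define H where "H = (\<chi> i j. h i j)"
    have "(u \<longlongrightarrow> u x) ?L"
      using continuous_on_closure_tendsto u xc unfolding Ck_closure_def by blast
    moreover have "u x = 0" using bvp x unfolding solves_bvp_def by blast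
    ultimately have u0: "(u \<longlongrightarrow> 0) ?L" by simp
    have limJ: "(?J \<longlongrightarrow> (x, 0, 0, H)) ?L"
      unfolding jet_of_def[abs_def]
      by (intro tendsto_Pair tendsto_ident_at u0 vec_tendstoI)
         (simp_all add: X_grad_def X_hess_def H_def grad0 smooth_X h)
    have inJ: "(x, 0, 0, H) \<in> closure (jet_domain \<Omega>)"
      using xc by (simp add: jet_domain_def closure_Times)
    have evJ: "eventually (\<lambda>y. ?J y \<in> closure (jet_domain \<Omega>)) ?L"
      using jet_of_image[of X u \<Omega>] closure_subset[of "jet_domain \<Omega>"]
      by (auto simp: eventually_at_topological)
    have F_cont: "continuous_on (closure (jet_domain \<Omega>)) F"
      by (rule continuous_on_subset[OF Ck_on_imp_continuous_on[OF N(3)] N(2)])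
    have lim\<phi>: "(\<phi> \<longlongrightarrow> F (x, 0, 0, H)) ?L"
      unfolding \<phi>_def by (rule continuous_on_tendsto_compose[OF F_cont limJ inJ evJ])
    have limG: "(G i j \<longlongrightarrow> d_r F i j (x, 0, 0, H)) ?L" for i j
      unfolding G_def by (rule continuous_on_tendsto_compose[OF Dr_cont limJ inJ evJ])
    define c where "c = F (x, 0, 0, H) - (\<Sum>i\<in>UNIV. \<Sum>j\<in>UNIV. h i j * d_r F i j (x, 0, 0, H))"
    have "(V \<longlongrightarrow> c *\<^sub>R euler_field \<sigma> x) ?L"
      unfolding V_def c_def
      by (rule tendsto_pohozaev_field[OF smooth_X domain(1) xc u3 p1 G2 grad0[OF smooth_X]
            grad0[OF smooth_euler_field] h limG lim\<phi>])
    moreover have "(W \<longlongrightarrow> W x) ?L" by (rule continuous_on_closure_tendsto[OF W(1) xc])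
    then have "(V \<longlongrightarrow> W x) ?L"
      by (rule Lim_transform_eventually) (auto simp: eventually_at_topological W(2))
    ultimately have "W x = c *\<^sub>R euler_field \<sigma> x"
      by (rule tendsto_unique[OF nontriv, rotated])
    moreover have "c \<le> 0" using i[OF x, of H] by (simp add: c_def H_def)
    moreover have "0 \<le> euler_field \<sigma> x \<bullet> outward_normal \<Omega> x"
      using star x unfolding dil_star_shaped_def by blast
    ultimately show ?thesis by (simp add: mult_nonpos_nonneg)
  qed

  have density0: "\<rho> x = 0" if x: "x \<in> \<Omega>" for x
    using divergence_zero_of_inward_flux[OF regular domain(1,2) W1 _ boundary x] div_W x ii
    by (simp add: \<rho>_def)
  have \<sigma>: "0 < \<sigma> k" for k
  proof -
    have "Min UNIV \<le> k" by simp
    then have "\<sigma> (Min UNIV) \<le> \<sigma> k" using exponents unfolding dilation_exponents_def mono_def by blast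
    then show ?thesis using exponents unfolding dilation_exponents_def by linarith
  qed
  show "u x0 = 0"
  proof (rule vanishing_product_imp_zero[OF smooth_X H1 H2 \<sigma> domain(1,2) _ _ _ _ x0])
    show "continuous_on (closure \<Omega>) u" using u by (simp add: Ck_closure_def)
    show "Ck_extends 3 u \<Omega>" using u3 by (simp add: numeral_3_eq_3)
    show "u x = 0" if "x \<in> frontier \<Omega>" for x using bvp that unfolding solves_bvp_def by blast
    show "u x = 0 \<or> X_grad X u x = 0 \<or> X_hess X u x = 0" if "x \<in> \<Omega>" for x
      using iii[OF that] density0[OF that] by (simp add: \<rho>_def)
  qed
qed

end
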